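(* There are absolute constants $c_0,C>0$ such that the following holds. Let $G$ be an abelian group, $A\subseteq G$ a finite set, $k\ge 2$ a positive integer, and suppose that $\mathsf{T}_k(A)=c|A|^{2k-1}$. Then there is a set $A_*\subseteq A$ such that $$\mathsf{T}_k(A,\dots,A,A_*,A_* )\ \ge\ 2^{-5}\,\mathsf{T}_k(A)$$ (where $A$ occurs in the first $2k-2$ of the $2k$ arguments and $A_*$ in the last two) and $$\dim(A_* )\le C\,\frac{\mathsf{T}_{k-1}(A)\,|A|^2}{\mathsf{T}_k(A)}\log(c^{-1}|A|)\le C\,c^{-1/(k-1)}\log(c^{-1}|A|).$$ In particular, $|A_*|\ge c_0\,c^{1/(2k-1)}|A|$.
   Context: For sets $A_1,\dots,A_{2k}\subseteq G$, $\mathsf{T}_k(A_1,\dots,A_{2k})=|\{(a_1,\dots,a_{2k}) : a_1+\dots+a_k=a_{k+1}+\dots+a_{2k},\ a_i\in A_i \text{ for } 1\le i\le 2k\}|$. For a positive integer $l$, $\mathsf{T}_l(A)=|\{(a_1,\dots,a_l,a'_1,\dots,a'_l)\in A^{2l} : a_1+\dots+a_l=a'_1+\dots+a'_l\}|$ (so $\mathsf{T}_1(A)=|A|$). All logarithms are to base $2$. A finite subset $\Lambda$ of an abelian group is dissociated if $\sum_{\lambda\in\Lambda}\varepsilon_\lambda\lambda=0$ with all $\varepsilon_\lambda\in\{-1,0,1\}$ implies $\varepsilon_\lambda=0$ for all $\lambda$. For a finite set $B$, $\dim(B)$ is the maximal cardinality of a dissociated subset of $B$.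
   Formalization: The bound on dim(A_* ) is not claimed for A={x}, x≠0, where it fails (c=1, log(c^{-1}|A|)=0, dim(A_* )=1). The constants are fixed for all G inside one underlying type; the countable case gives all G, since A generates a countable subgroup. *)

theory Defs
  imports Complex_Main "HOL-Library.FuncSet" "HOL-Algebra.FiniteProduct"
begin

text \<open>
  Abelian groups are \<^const>\<open>comm_group\<close> records, so the group law is written
  multiplicatively: sums become \<open>finprod\<close>, zero becomes \<open>\<one>\<close>, and an integer multiple
  becomes an integer power. Records rather than the class \<^class>\<open>ab_group_add\<close> are used because
  a bound with absolute constants has to quantify over the group after the constants.
\<close>

definition add_energy :: "('g, 'm) monoid_scheme \<Rightarrow> nat \<Rightarrow> (nat \<Rightarrow> 'g set) \<Rightarrow> nat" where
  "add_energy G k As =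
     card {a \<in> (\<Pi>\<^sub>E i\<in>{1..2*k}. As i).
             (\<Otimes>\<^bsub>G\<^esub>i\<in>{1..k}. a i) = (\<Otimes>\<^bsub>G\<^esub>i\<in>{k+1..2*k}. a i)}"

abbreviation energy :: "('g, 'm) monoid_scheme \<Rightarrow> nat \<Rightarrow> 'g set \<Rightarrow> nat" where
  "energy G l A \<equiv> add_energy G l (\<lambda>_. A)"

definition dissociated :: "('g, 'm) monoid_scheme \<Rightarrow> 'g set \<Rightarrow> bool" where
  "dissociated G \<Lambda> \<longleftrightarrow>
     finite \<Lambda> \<and> \<Lambda> \<subseteq> carrier G \<and>
     (\<forall>\<epsilon> :: 'g \<Rightarrow> int.
        (\<forall>x\<in>\<Lambda>. \<epsilon> x \<in> {-1, 0, 1}) \<and> (\<Otimes>\<^bsub>G\<^esub>x\<in>\<Lambda>. x [^]\<^bsub>G\<^esub> \<epsilon> x) = \<one>\<^bsub>G\<^esub> \<longrightarrow>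
        (\<forall>x\<in>\<Lambda>. \<epsilon> x = 0))"

definition diss_dim :: "('g, 'm) monoid_scheme \<Rightarrow> 'g set \<Rightarrow> nat" where
  "diss_dim G B = Max {card \<Lambda> | \<Lambda>. \<Lambda> \<subseteq> B \<and> dissociated G \<Lambda>}"

end

theory Submission
  imports Defs "HOL-Analysis.L2_Norm" "HOL-Combinatorics.List_Permutation"
begin

text \<open>
  Remove from \<open>A\<close> disjoint dissociated sets \<open>\<Lambda>\<close> of size \<open>d\<close> until none is left; what remains is the
  required set \<open>A'\<close>, of dimension less than \<open>d\<close>. If \<open>M i\<close> counts the coincidences
  between tuples with \<open>k - 1\<close> entries in \<open>A\<close> and \<open>i\<close> in \<open>\<Lambda>\<close>, then \<open>M\<close> is log-convex, so that
  \<open>M 1 ^ p \<le> M 0 ^ (p - 1) * M p\<close>. Rudin's inequality bounds the energy of order \<open>p\<close> of \<open>\<Lambda>\<close> by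
  \<open>(4 p d) ^ p\<close>, and for \<open>p\<close> about \<open>log (|A| / c)\<close> this yields
  \<open>M 1 \<le> 8 p d T\<^sub>k\<^sub>-\<^sub>1(A)\<close>. Adding over the removed sets, the removed part carries a small
  proportion of \<open>T\<^sub>k(A)\<close> as soon as \<open>d\<close> exceeds a multiple of \<open>p T\<^sub>k\<^sub>-\<^sub>1(A) |A|\<^sup>2 / T\<^sub>k(A)\<close>.
  No characters are needed: all norms are those of representation functions, and Rudin's
  inequality for such a norm only uses that subset sums of a dissociated set are distinct. Log-convexity
  also gives the second bound on the dimension and the lower bound on \<open>|A'|\<close>.
\<close>

section \<open>Coincidence counts\<close>

text \<open>The inner product of the two functions that count fibres. Sets and maps are arbitrary
  because lists, triples with quotient maps and pairs of lists all occur below.\<close>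

definition coincidences :: "'a set \<Rightarrow> ('a \<Rightarrow> 'c) \<Rightarrow> 'b set \<Rightarrow> ('b \<Rightarrow> 'c) \<Rightarrow> real" where
  "coincidences X \<phi> Y \<psi> = real (card {z \<in> X \<times> Y. \<phi> (fst z) = \<psi> (snd z)})"

text \<open>The Euclidean norm of the function \<open>g \<mapsto> card {x \<in> X. \<phi> x = g}\<close>.\<close>

definition fibre_norm :: "'a set \<Rightarrow> ('a \<Rightarrow> 'c) \<Rightarrow> real" where
  "fibre_norm X \<phi> = sqrt (coincidences X \<phi> X \<phi>)"

lemma fibre_norm_nonneg: "0 \<le> fibre_norm X \<phi>"
  by (simp add: fibre_norm_def coincidences_def)

lemma fibre_norm_square: "fibre_norm X \<phi> ^ 2 = coincidences X \<phi> X \<phi>"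
  by (simp add: fibre_norm_def coincidences_def)

lemma coincidences_sum_fibres:
  assumes "finite X" "finite Y" "finite V" "\<phi> ` X \<subseteq> V"
  shows "coincidences X \<phi> Y \<psi> =
    (\<Sum>v\<in>V. real (card {x\<in>X. \<phi> x = v}) * real (card {y\<in>Y. \<psi> y = v}))"
proof -
  have eq: "{z \<in> X \<times> Y. \<phi> (fst z) = \<psi> (snd z)}
      = (\<Union>v\<in>V. {x\<in>X. \<phi> x = v} \<times> {y\<in>Y. \<psi> y = v})"
    using assms(4) by auto
  show ?thesis
    unfolding coincidences_def eq using assms
    by (subst card_UN_disjoint) (auto simp: card_cartesian_product)
qed

lemma coincidences_Cauchy_Schwarz:
  assumes "finite X" "finite Y"
  shows "coincidences X \<phi> Y \<psi> \<le> fibre_norm X \<phi> * fibre_norm Y \<psi>"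
proof -
  \<comment> \<open>Both images, so that the two norms become sums over the same set.\<close>
  let ?V = "\<phi> ` X \<union> \<psi> ` Y"
  let ?f = "\<lambda>v. real (card {x\<in>X. \<phi> x = v})" and ?g = "\<lambda>v. real (card {y\<in>Y. \<psi> y = v})"
  have V: "finite ?V" "\<phi> ` X \<subseteq> ?V" "\<psi> ` Y \<subseteq> ?V"
    using assms by auto
  have "coincidences X \<phi> Y \<psi> = (\<Sum>v\<in>?V. \<bar>?f v\<bar> * \<bar>?g v\<bar>)"
    using coincidences_sum_fibres[OF assms V(1,2)] by simp
  also have "\<dots> \<le> L2_set ?f ?V * L2_set ?g ?V"
    by (rule L2_set_mult_ineq)
  also have "L2_set ?f ?V = fibre_norm X \<phi>"
    using coincidences_sum_fibres[OF assms(1) assms(1) V(1,2)] by (simp add: L2_set_def fibre_norm_def power2_eq_square)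
  also have "L2_set ?g ?V = fibre_norm Y \<psi>"
    using coincidences_sum_fibres[OF assms(2) assms(2) V(1,3)] by (simp add: L2_set_def fibre_norm_def power2_eq_square)
  finally show ?thesis .
qed

lemma coincidences_inj_le:
  assumes "inj_on h X" "inj_on k Y" "h ` X \<subseteq> X'" "k ` Y \<subseteq> Y'" "finite X'" "finite Y'"
    and "\<And>x y. x \<in> X \<Longrightarrow> y \<in> Y \<Longrightarrow> \<phi> x = \<psi> y \<Longrightarrow> \<phi>' (h x) = \<psi>' (k y)"
  shows "coincidences X \<phi> Y \<psi> \<le> coincidences X' \<phi>' Y' \<psi>'"
proof -
  have "card {z \<in> X \<times> Y. \<phi> (fst z) = \<psi> (snd z)} \<le> card {z \<in> X' \<times> Y'. \<phi>' (fst z) = \<psi>' (snd z)}"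
  proof (rule card_inj_on_le[where f = "map_prod h k"])
    show "inj_on (map_prod h k) {z \<in> X \<times> Y. \<phi> (fst z) = \<psi> (snd z)}"
      using assms(1,2) by (auto intro: inj_on_subset[OF map_prod_inj_on])
  qed (use assms in auto)
  then show ?thesis by (simp add: coincidences_def)
qed

text \<open>Used whenever tuples are re-encoded: an injective map that preserves every coincidence
  can only increase their number.\<close>

lemma fibre_norm_inj_le:
  assumes "inj_on h X" "h ` X \<subseteq> Y" "finite Y"
    and "\<And>x x'. x \<in> X \<Longrightarrow> x' \<in> X \<Longrightarrow> \<phi> x = \<phi> x' \<Longrightarrow> \<psi> (h x) = \<psi> (h x')"
  shows "fibre_norm X \<phi> \<le> fibre_norm Y \<psi>"
  unfolding fibre_norm_def by (rule real_sqrt_le_mono, rule coincidences_inj_le[OF assms(1,1,2,2,3,3)], rule assms(4))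

text \<open>The triangle inequality for counting functions: expand the square into pairs of pieces
  and apply Cauchy-Schwarz to each pair. Overlaps do no harm, since only an upper bound is
  claimed.\<close>

lemma fibre_norm_cover:
  assumes "finite I" "\<And>i. i \<in> I \<Longrightarrow> finite (F i)" "X \<subseteq> (\<Union>i\<in>I. F i)"
  shows "fibre_norm X \<phi> \<le> (\<Sum>i\<in>I. fibre_norm (F i) \<phi>)"
proof -
  let ?D = "\<lambda>i j. {z \<in> F i \<times> F j. \<phi> (fst z) = \<phi> (snd z)}"
  have "card {z \<in> X \<times> X. \<phi> (fst z) = \<phi> (snd z)} \<le> card (\<Union>p\<in>I\<times>I. ?D (fst p) (snd p))"
  proof (rule card_mono)
    show "finite (\<Union>p\<in>I\<times>I. ?D (fst p) (snd p))"
    proof (rule finite_UN_I)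
      show "finite (?D (fst p) (snd p))" if "p \<in> I \<times> I" for p
        by (rule finite_subset[of _ "F (fst p) \<times> F (snd p)"]) (use that assms(2) in auto)
    qed (use assms(1) in blast)
    show "{z \<in> X \<times> X. \<phi> (fst z) = \<phi> (snd z)} \<subseteq> (\<Union>p\<in>I\<times>I. ?D (fst p) (snd p))"
    proof
      fix z assume z: "z \<in> {z \<in> X \<times> X. \<phi> (fst z) = \<phi> (snd z)}"
      then have "fst z \<in> X" "snd z \<in> X"
        by (auto simp only: mem_Collect_eq mem_Times_iff)
      then obtain i j where "i \<in> I" "j \<in> I" "fst z \<in> F i" "snd z \<in> F j"
        using assms(3) by blast
      then have "(i, j) \<in> I \<times> I" "z \<in> ?D (fst (i, j)) (snd (i, j))"
        using z by (auto simp only: mem_Collect_eq mem_Times_iff fst_conv snd_conv)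
      then show "z \<in> (\<Union>p\<in>I\<times>I. ?D (fst p) (snd p))"
        by (rule UN_I)
    qed
  qed
  also have "\<dots> \<le> (\<Sum>p\<in>I\<times>I. card (?D (fst p) (snd p)))"
    using assms(1) by (intro card_UN_le finite_cartesian_product)
  finally have le: "card {z \<in> X \<times> X. \<phi> (fst z) = \<phi> (snd z)} \<le> (\<Sum>p\<in>I\<times>I. card (?D (fst p) (snd p)))" .
  have "coincidences X \<phi> X \<phi> \<le> (\<Sum>p\<in>I\<times>I. coincidences (F (fst p)) \<phi> (F (snd p)) \<phi>)"
    using of_nat_mono[OF le, where ?'a = real] unfolding coincidences_def of_nat_sum .
  also have "\<dots> \<le> (\<Sum>p\<in>I\<times>I. fibre_norm (F (fst p)) \<phi> * fibre_norm (F (snd p)) \<phi>)"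
    by (intro sum_mono coincidences_Cauchy_Schwarz assms(2)) auto
  also have "\<dots> = (\<Sum>i\<in>I. fibre_norm (F i) \<phi>) ^ 2"
    using sum_product[of "\<lambda>i. fibre_norm (F i) \<phi>" I "\<lambda>i. fibre_norm (F i) \<phi>"]
      sum.cartesian_product[of "\<lambda>i j. fibre_norm (F i) \<phi> * fibre_norm (F j) \<phi>" I I]
    by (simp add: power2_eq_square case_prod_beta')
  finally have "fibre_norm X \<phi> ^ 2 \<le> (\<Sum>i\<in>I. fibre_norm (F i) \<phi>) ^ 2"
    by (simp add: fibre_norm_square)
  then show ?thesis
    by (rule power2_le_imp_le) (simp add: sum_nonneg fibre_norm_nonneg)
qed

text \<open>Log-convexity says that the ratios \<open>e (i + 1) / e i\<close> do not decrease, so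
  the product of the first \<open>p\<close> of them is at least the \<open>p\<close>-th power of the
  first.\<close>

lemma log_convex_power_le:
  fixes e :: "nat \<Rightarrow> real"
  assumes pos: "\<And>i. i \<le> p \<Longrightarrow> e i > 0"
    and conv: "\<And>i. i + 2 \<le> p \<Longrightarrow> e (i + 1) ^ 2 \<le> e i * e (i + 2)"
    and "p \<ge> 1"
  shows "e 1 ^ p \<le> e 0 ^ (p - 1) * e p"
proof -
  have step: "e 1 * e i \<le> e 0 * e (i + 1)" if "i + 1 \<le> p" for i
    using that
  proof (induction i)
    case (Suc i)
    have p: "e i > 0" "e (i+1) > 0" "e 0 > 0" "e 1 > 0"
      using Suc.prems by (auto intro!: pos)
    \<comment> \<open>The extra factor \<open>e i * e (i + 1)\<close> brings in the convexity
      hypothesis and is cancelled at the end.\<close>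
    have "(e 1 * e (i + 1)) * (e i * e (i + 1)) = (e 1 * e i) * e (i + 1) ^ 2"
      by (simp add: power2_eq_square)
    also have "\<dots> \<le> (e 0 * e (i + 1)) * (e i * e (i + 2))"
      using Suc conv[of i] p by (intro mult_mono[where a = "e 1 * e i" and b = "e 0 * e (i + 1)"]) auto
    finally have "(e 1 * e (i + 1)) * (e i * e (i + 1)) \<le> (e 0 * e (i + 2)) * (e i * e (i + 1))"
      by (simp add: algebra_simps)
    then show ?case using p by (simp add: mult_le_cancel_right)
  qed simp
  have "e 1 ^ (n + 1) \<le> e 0 ^ n * e (n + 1)" if "n + 1 \<le> p" for n
    using that
  proof (induction n)
    case (Suc n)
    have "e 1 ^ (Suc n + 1) \<le> e 1 * (e 0 ^ n * e (n + 1))"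
      using Suc pos[of 1] by simp
    also have "\<dots> = e 0 ^ n * (e 1 * e (n + 1))" by simp
    also have "\<dots> \<le> e 0 ^ n * (e 0 * e (n + 2))"
      using Suc.prems pos[of 0] step[of "n + 1"] by (intro mult_left_mono) auto
    finally show ?case by (simp add: algebra_simps)
  qed simp
  from this[of "p - 1"] show ?thesis using \<open>p \<ge> 1\<close> by simp
qed

section \<open>Energies of lists of sets\<close>

text \<open>Cartesian products with varying factors. Lists allow induction on the factors and make
  reordering them a permutation.\<close>

definition tuples :: "'a set list \<Rightarrow> 'a list set" where
  "tuples Ls = {xs. list_all2 (\<in>) xs Ls}"

lemma tuples_Nil [simp]: "tuples [] = {[]}"
  by (auto simp: tuples_def)

lemma tuples_Cons: "tuples (A # Ls) = (\<lambda>(x, xs). x # xs) ` (A \<times> tuples Ls)"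
  by (auto simp: tuples_def list_all2_Cons2)

lemma Cons_in_tuples [simp]: "x # xs \<in> tuples (A # Ls) \<longleftrightarrow> x \<in> A \<and> xs \<in> tuples Ls"
  by (simp add: tuples_def)

lemma finite_tuples: "\<forall>A\<in>set Ls. finite A \<Longrightarrow> finite (tuples Ls)"
  by (induction Ls) (auto simp: tuples_Cons)

lemma tuples_nonempty: "\<forall>A\<in>set Ls. A \<noteq> {} \<Longrightarrow> tuples Ls \<noteq> {}"
  by (induction Ls) (auto simp: tuples_Cons)

lemma tuples_replicate: "tuples (replicate n A) = {xs. length xs = n \<and> set xs \<subseteq> A}"
  by (induction n) (auto simp: tuples_Cons image_iff length_Suc_conv)

context comm_group
begin

definition lprod :: "'a list \<Rightarrow> 'a" where
  "lprod xs = foldr (\<otimes>) xs \<one>"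

abbreviation fin_subsets :: "'a set set" where
  "fin_subsets \<equiv> {A. finite A \<and> A \<subseteq> carrier G}"

text \<open>The squared Euclidean norm of the convolution of the indicator functions of the sets in
  \<open>Ls\<close>; for \<open>replicate k A\<close> it is the energy of order
  \<open>k\<close>.\<close>

definition tuple_energy :: "'a set list \<Rightarrow> real" where
  "tuple_energy Ls = coincidences (tuples Ls) lprod (tuples Ls) lprod"

lemma lprod_Nil [simp]: "lprod [] = \<one>"
  by (simp add: lprod_def)

lemma lprod_Cons [simp]: "lprod (x # xs) = x \<otimes> lprod xs"
  by (simp add: lprod_def)

lemma lprod_closed [simp]: "set xs \<subseteq> carrier G \<Longrightarrow> lprod xs \<in> carrier G"
  by (induction xs) auto

lemma lprod_append:
  "set xs \<subseteq> carrier G \<Longrightarrow> set ys \<subseteq> carrier G \<Longrightarrow> lprod (xs @ ys) = lprod xs \<otimes> lprod ys"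
  by (induction xs) (auto simp: m_assoc)

lemma lprod_mset_cong:
  "mset xs = mset ys \<Longrightarrow> set xs \<subseteq> carrier G \<Longrightarrow> lprod xs = lprod ys"
proof (induction xs arbitrary: ys)
  case (Cons x xs)
  then have "x \<in> set ys" by (metis list.set_intros(1) set_mset_mset)
  then obtain us vs where ys: "ys = us @ x # vs" by (meson split_list)
  have "set ys \<subseteq> carrier G" using Cons.prems by (metis set_mset_mset)
  then have sub: "set us \<subseteq> carrier G" "set vs \<subseteq> carrier G" "x \<in> carrier G"
    using ys by auto
  have "mset xs = mset (us @ vs)" using Cons.prems(1) ys by simp
  then have "lprod xs = lprod (us @ vs)" using Cons by simp
  then show ?case using sub by (simp add: ys lprod_append m_lcomm)
qed simp

lemma set_tuples_subset: "xs \<in> tuples Ls \<Longrightarrow> set Ls \<subseteq> fin_subsets \<Longrightarrow> set xs \<subseteq> carrier G"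
  unfolding tuples_def by (auto simp: list_all2_conv_all_nth in_set_conv_nth subset_iff)

lemma lprod_tuples_closed: "xs \<in> tuples Ls \<Longrightarrow> set Ls \<subseteq> fin_subsets \<Longrightarrow> lprod xs \<in> carrier G"
  by (simp add: set_tuples_subset)

lemma finite_tuples': "set Ls \<subseteq> fin_subsets \<Longrightarrow> finite (tuples Ls)"
  by (rule finite_tuples) auto

lemma tuple_energy_eq_fibre_norm: "tuple_energy Ls = fibre_norm (tuples Ls) lprod ^ 2"
  by (simp add: tuple_energy_def fibre_norm_square)

lemma tuple_energy_nonneg: "0 \<le> tuple_energy Ls"
  by (simp add: tuple_energy_eq_fibre_norm)

lemma tuple_energy_pos:
  assumes "set Ls \<subseteq> fin_subsets" "\<forall>A\<in>set Ls. A \<noteq> {}"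
  shows "tuple_energy Ls > 0"
proof -
  obtain xs where "xs \<in> tuples Ls" using tuples_nonempty[OF assms(2)] by blast
  then have "(xs, xs) \<in> {z \<in> tuples Ls \<times> tuples Ls. lprod (fst z) = lprod (snd z)}" by simp
  moreover have "finite {z \<in> tuples Ls \<times> tuples Ls. lprod (fst z) = lprod (snd z)}"
    using finite_tuples'[OF assms(1)] by simp
  ultimately show ?thesis
    unfolding tuple_energy_def coincidences_def of_nat_0_less_iff card_gt_0_iff by blast
qed

text \<open>Permuting the positions of a tuple is injective and, in a commutative group, leaves its
  product unchanged.\<close>

lemma fibre_norm_tuples_mset_le:
  assumes "mset Ls = mset Ms" "set Ms \<subseteq> fin_subsets"
  shows "fibre_norm (tuples Ms) lprod \<le> fibre_norm (tuples Ls) lprod"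
proof -
  obtain p where p: "p permutes {..<length Ms}" "permute_list p Ms = Ls"
    using mset_eq_permutation[OF assms(1)] .
  have len: "length xs = length Ms" if "xs \<in> tuples Ms" for xs
    using that by (auto simp: tuples_def list_all2_lengthD)
  have lp: "lprod (permute_list p xs) = lprod xs" if "xs \<in> tuples Ms" for xs
    using that p len assms(2) by (intro lprod_mset_cong) (auto dest!: set_tuples_subset)
  show ?thesis
  proof (rule fibre_norm_inj_le[where h = "permute_list p"])
    show "inj_on (permute_list p) (tuples Ms)"
    proof (rule inj_on_inverseI[where g = "permute_list (inv_into UNIV p)"])
      fix xs assume "xs \<in> tuples Ms"
      then have "length xs = length Ms" by (rule len)
      then show "permute_list (inv_into UNIV p) (permute_list p xs) = xs"
        using p(1) permute_list_compose[of "inv_into UNIV p" xs p]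
        by (simp add: permutes_inv permutes_inv_o)
    qed
    show "permute_list p ` tuples Ms \<subseteq> tuples Ls"
      using p len by (auto simp: tuples_def list_all2_permute_list_iff)
    show "finite (tuples Ls)"
      using assms by (metis finite_tuples' set_mset_mset)
  qed (simp add: lp)
qed

lemma tuple_energy_mset_cong:
  assumes "mset Ls = mset Ms" "set Ms \<subseteq> fin_subsets"
  shows "tuple_energy Ls = tuple_energy Ms"
  unfolding tuple_energy_eq_fibre_norm using assms fibre_norm_tuples_mset_le[of Ls Ms] fibre_norm_tuples_mset_le[of Ms Ls]
  by (metis order_antisym set_mset_mset)

text \<open>Fixing the first entry leaves a translate of the tuples over \<open>Ls\<close>, and
  cancelling that entry shows that the norm is no larger. The triangle inequality adds up
  \<open>card A\<close> such slices.\<close>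

lemma fibre_norm_Cons_le:
  assumes "finite A" "A \<subseteq> carrier G" "set Ls \<subseteq> fin_subsets"
  shows "fibre_norm (tuples (A # Ls)) lprod \<le> card A * fibre_norm (tuples Ls) lprod"
proof -
  have "fibre_norm (tuples (A # Ls)) lprod \<le> (\<Sum>a\<in>A. fibre_norm (Cons a ` tuples Ls) lprod)"
    by (rule fibre_norm_cover) (use assms finite_tuples'[OF assms(3)] in \<open>auto simp: tuples_Cons\<close>)
  also have "\<dots> \<le> (\<Sum>a\<in>A. fibre_norm (tuples Ls) lprod)"
  proof (rule sum_mono)
    fix a assume "a \<in> A"
    then show "fibre_norm (Cons a ` tuples Ls) lprod \<le> fibre_norm (tuples Ls) lprod"
      using assms
      by (intro fibre_norm_inj_le[where h = tl])
         (auto simp: inj_on_def finite_tuples' subset_iff lprod_tuples_closed)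
  qed
  finally show ?thesis by simp
qed

lemma tuple_energy_Cons_le:
  assumes "finite A" "A \<subseteq> carrier G" "set Ls \<subseteq> fin_subsets"
  shows "tuple_energy (A # Ls) \<le> real (card A) ^ 2 * tuple_energy Ls"
  using power_mono[OF fibre_norm_Cons_le[OF assms] fibre_norm_nonneg, of 2]
  by (simp add: tuple_energy_eq_fibre_norm power_mult_distrib)

text \<open>The identity is neutral, so \<open>{\<one>}\<close> can pad a list. This makes
  interpolation available between lists of different lengths.\<close>

lemma tuple_energy_Cons_one:
  assumes "set Ls \<subseteq> fin_subsets"
  shows "tuple_energy ({\<one>} # Ls) = tuple_energy Ls"
proof -
  have "fibre_norm (tuples Ls) lprod \<le> fibre_norm (tuples ({\<one>} # Ls)) lprod"
    using assms
    by (intro fibre_norm_inj_le[where h = "Cons \<one>"]) (auto simp: finite_tuples' lprod_tuples_closed)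
  moreover have "fibre_norm (tuples ({\<one>} # Ls)) lprod \<le> fibre_norm (tuples Ls) lprod"
    using fibre_norm_Cons_le[of "{\<one>}" Ls] assms by simp
  ultimately show ?thesis by (simp add: tuple_energy_eq_fibre_norm)
qed

lemma tuple_energy_replicate_one:
  assumes "set Ls \<subseteq> fin_subsets"
  shows "tuple_energy (replicate n {\<one>} @ Ls) = tuple_energy Ls"
proof (induction n)
  case (Suc n)
  have "set (replicate n {\<one>} @ Ls) \<subseteq> fin_subsets" using assms by auto
  then show ?case using Suc tuple_energy_Cons_one[of "replicate n {\<one>} @ Ls"] by simp
qed simp

lemma tuple_energy_replicate_le:
  assumes "finite A" "A \<subseteq> carrier G" "set Ls \<subseteq> fin_subsets"
  shows "tuple_energy (replicate n A @ Ls) \<le> real (card A) ^ (2 * n) * tuple_energy Ls"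
proof (induction n)
  case (Suc n)
  have "tuple_energy (A # replicate n A @ Ls) \<le> real (card A) ^ 2 * tuple_energy (replicate n A @ Ls)"
    using assms by (intro tuple_energy_Cons_le) auto
  also have "\<dots> \<le> real (card A) ^ 2 * (real (card A) ^ (2 * n) * tuple_energy Ls)"
    using Suc by (intro mult_left_mono) auto
  finally show ?case by (simp add: power2_eq_square mult.assoc)
qed simp

text \<open>Clearing the denominators \<open>b\<close> and \<open>d\<close> passes from equations
  between quotients to the equations counted by \<open>tuple_energy\<close>.\<close>

lemma m_inv_eq_iff:
  assumes "a \<in> carrier G" "b \<in> carrier G" "c \<in> carrier G" "d \<in> carrier G"
    "x \<in> carrier G" "y \<in> carrier G"
  shows "a \<otimes> inv b \<otimes> x = c \<otimes> inv d \<otimes> y \<longleftrightarrow> a \<otimes> (d \<otimes> x) = b \<otimes> (c \<otimes> y)"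
proof -
  have ac: "(u \<otimes> v) \<otimes> (w \<otimes> t \<otimes> s) = (u \<otimes> t) \<otimes> (w \<otimes> (v \<otimes> s))"
    if "u \<in> carrier G" "v \<in> carrier G" "w \<in> carrier G" "t \<in> carrier G" "s \<in> carrier G" for u v w t s
    using that by (simp add: m_ac)
  have "a \<otimes> inv b \<otimes> x = c \<otimes> inv d \<otimes> y \<longleftrightarrow>
      (b \<otimes> d) \<otimes> (a \<otimes> inv b \<otimes> x) = (b \<otimes> d) \<otimes> (c \<otimes> inv d \<otimes> y)"
    using assms by simp
  also have "(b \<otimes> d) \<otimes> (a \<otimes> inv b \<otimes> x) = (b \<otimes> inv b) \<otimes> (a \<otimes> (d \<otimes> x))"
    using assms by (intro ac) auto
  also have "(b \<otimes> d) \<otimes> (c \<otimes> inv d \<otimes> y) = (d \<otimes> inv d) \<otimes> (b \<otimes> (c \<otimes> y))"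
    using assms ac[of d b c "inv d" y] by (simp add: m_comm m_lcomm)
  finally show ?thesis using assms by simp
qed

text \<open>Moving one factor from each side to the other turns the quadruple counts into counts of
  coincidences between quotients \<open>a b\<inverse> z\<close>, to which the Cauchy--Schwarz inequality applies.\<close>

lemma tuple_energy_log_convex:
  assumes "finite A" "A \<subseteq> carrier G" "finite B" "B \<subseteq> carrier G" "set Z \<subseteq> fin_subsets"
  shows "tuple_energy (A # B # Z) ^ 2 \<le> tuple_energy (A # A # Z) * tuple_energy (B # B # Z)"
proof -
  define \<phi> where "\<phi> = (\<lambda>(a, b, z). a \<otimes> inv b \<otimes> lprod z)"
  let ?U = "\<lambda>A. A \<times> A \<times> tuples Z"
  have fin: "finite (tuples Z)" by (rule finite_tuples') fact
  have z: "z \<in> tuples Z \<Longrightarrow> lprod z \<in> carrier G" for z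
    using assms by (simp add: lprod_tuples_closed)
  have sq: "coincidences (?U A) \<phi> (?U A) \<phi> \<le> tuple_energy (A # A # Z)" if A: "finite A" "A \<subseteq> carrier G" for A
  proof -
    \<comment> \<open>From \<open>a b\<inverse> z = c d\<inverse> w\<close> to
      \<open>a d z = b c w\<close>, where \<open>a\<close>, \<open>b\<close>, \<open>c\<close>,
      \<open>d\<close> all lie in the same set.\<close>
    let ?h = "\<lambda>((a, b, z), (c, d, w)). (a # d # z, b # c # w)"
    have "card {q \<in> ?U A \<times> ?U A. \<phi> (fst q) = \<phi> (snd q)}
       \<le> card {q \<in> tuples (A # A # Z) \<times> tuples (A # A # Z). lprod (fst q) = lprod (snd q)}"
    proof (rule card_inj_on_le[where f = ?h])
      show "inj_on ?h {q \<in> ?U A \<times> ?U A. \<phi> (fst q) = \<phi> (snd q)}"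
        by (auto simp: inj_on_def)
      show "?h ` {q \<in> ?U A \<times> ?U A. \<phi> (fst q) = \<phi> (snd q)}
        \<subseteq> {q \<in> tuples (A # A # Z) \<times> tuples (A # A # Z). lprod (fst q) = lprod (snd q)}"
        using A z by (auto simp: \<phi>_def subset_iff m_inv_eq_iff)
      show "finite {q \<in> tuples (A # A # Z) \<times> tuples (A # A # Z). lprod (fst q) = lprod (snd q)}"
        using A fin by (simp add: tuples_Cons)
    qed
    then show ?thesis by (simp add: coincidences_def tuple_energy_def)
  qed
  let ?T = "tuples (A # B # Z)"
  \<comment> \<open>Here \<open>a b z = a' b' w\<close> becomes
    \<open>a a'\<inverse> z = b' b\<inverse> w\<close>. Apart from the tails, the left side involves
    only \<open>A\<close> and the right side only \<open>B\<close>, so Cauchy-Schwarz separates the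
    two sets.\<close>
  let ?g = "\<lambda>(xs, ys). ((hd xs, hd ys, tl (tl xs)), (hd (tl ys), hd (tl xs), tl (tl ys)))"
  have "card {q \<in> ?T \<times> ?T. lprod (fst q) = lprod (snd q)}
       \<le> card {q \<in> ?U A \<times> ?U B. \<phi> (fst q) = \<phi> (snd q)}"
  proof (rule card_inj_on_le[where f = ?g])
    show "inj_on ?g {q \<in> ?T \<times> ?T. lprod (fst q) = lprod (snd q)}"
      by (auto simp: inj_on_def tuples_Cons)
    show "?g ` {q \<in> ?T \<times> ?T. lprod (fst q) = lprod (snd q)}
        \<subseteq> {q \<in> ?U A \<times> ?U B. \<phi> (fst q) = \<phi> (snd q)}"
      using assms z by (auto simp: \<phi>_def subset_iff tuples_Cons m_inv_eq_iff)
    show "finite {q \<in> ?U A \<times> ?U B. \<phi> (fst q) = \<phi> (snd q)}"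
      using assms fin by simp
  qed
  then have "tuple_energy (A # B # Z) \<le> coincidences (?U A) \<phi> (?U B) \<phi>"
    by (simp add: coincidences_def tuple_energy_def)
  also have "\<dots> \<le> fibre_norm (?U A) \<phi> * fibre_norm (?U B) \<phi>"
    using assms fin by (intro coincidences_Cauchy_Schwarz) auto
  finally have "tuple_energy (A # B # Z) ^ 2 \<le> (fibre_norm (?U A) \<phi> * fibre_norm (?U B) \<phi>) ^ 2"
    by (intro power_mono tuple_energy_nonneg)
  also have "\<dots> = coincidences (?U A) \<phi> (?U A) \<phi> * coincidences (?U B) \<phi> (?U B) \<phi>"
    by (simp add: power_mult_distrib fibre_norm_square)
  also have "\<dots> \<le> tuple_energy (A # A # Z) * tuple_energy (B # B # Z)"
    using assms by (intro mult_mono sq tuple_energy_nonneg) (auto simp: coincidences_def)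
  finally show ?thesis .
qed

text \<open>Exchanging the copies of \<open>A\<close> for \<open>B\<close> one at a time gives a
  log-convex sequence: three consecutive lists consist of \<open>A A\<close>, \<open>A B\<close>,
  \<open>B B\<close> and the same remaining factors.\<close>

lemma tuple_energy_interpolate:
  assumes A: "finite A" "A \<subseteq> carrier G" "A \<noteq> {}" and B: "finite B" "B \<subseteq> carrier G" "B \<noteq> {}"
    and Z: "set Z \<subseteq> fin_subsets" "\<forall>S\<in>set Z. S \<noteq> {}" and p: "p \<ge> 1"
  shows "tuple_energy (B # replicate (p - 1) A @ Z) ^ p
    \<le> tuple_energy (replicate p A @ Z) ^ (p - 1) * tuple_energy (replicate p B @ Z)"
proof -
  define e where "e = (\<lambda>i. tuple_energy (replicate i B @ replicate (p - i) A @ Z))"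
  have "e 1 ^ p \<le> e 0 ^ (p - 1) * e p"
  proof (rule log_convex_power_le[OF _ _ p])
    show "e i > 0" for i
      unfolding e_def using assms by (intro tuple_energy_pos) auto
    fix i assume i: "i + 2 \<le> p"
    let ?R = "replicate i B @ replicate (p - i - 2) A @ Z"
    have R: "set ?R \<subseteq> fin_subsets" using assms by (simp add: set_replicate_conv_if)
    have r: "replicate (p - i) A = A # A # replicate (p - i - 2) A"
      "replicate (p - (i + 1)) A = A # replicate (p - i - 2) A"
      "replicate (p - (i + 2)) A = replicate (p - i - 2) A"
      using i by (auto simp: replicate_Suc[symmetric] Suc_diff_Suc simp del: replicate_Suc)
    have "e (i + 1) = tuple_energy (A # B # ?R)" "e i = tuple_energy (A # A # ?R)" "e (i + 2) = tuple_energy (B # B # ?R)"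
      unfolding e_def r by (intro tuple_energy_mset_cong; use R A B in simp)+
    then show "e (i + 1) ^ 2 \<le> e i * e (i + 2)"
      using tuple_energy_log_convex[OF A(1,2) B(1,2) R] by simp
  qed
  then show ?thesis by (simp add: e_def)
qed

section \<open>Rudin's inequality for dissociated sets\<close>

lemma dissociatedD:
  fixes \<epsilon> :: "'a \<Rightarrow> int"
  assumes "dissociated G \<Lambda>" "\<And>x. x \<in> \<Lambda> \<Longrightarrow> \<epsilon> x \<in> {-1, 0, 1}" "(\<Otimes>x\<in>\<Lambda>. x [^] \<epsilon> x) = \<one>" "x \<in> \<Lambda>"
  shows "\<epsilon> x = 0"
  using assms unfolding dissociated_def by blast

lemma dissociated_mono:
  assumes "dissociated G \<Lambda>" "\<Gamma> \<subseteq> \<Lambda>"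
  shows "dissociated G \<Gamma>"
  unfolding dissociated_def
proof (intro conjI allI impI)
  have fin: "finite \<Lambda>" and sub: "\<Lambda> \<subseteq> carrier G"
    using assms(1) by (auto simp: dissociated_def)
  then show "finite \<Gamma>" "\<Gamma> \<subseteq> carrier G"
    using assms(2) finite_subset by auto
  fix \<epsilon> :: "'a \<Rightarrow> int"
  assume \<epsilon>: "(\<forall>x\<in>\<Gamma>. \<epsilon> x \<in> {-1, 0, 1}) \<and> (\<Otimes>x\<in>\<Gamma>. x [^] \<epsilon> x) = \<one>"
  define \<epsilon>' where "\<epsilon>' = (\<lambda>x. if x \<in> \<Gamma> then \<epsilon> x else 0)"
  have "(\<Otimes>x\<in>\<Lambda>. x [^] \<epsilon>' x) = (\<Otimes>x\<in>\<Gamma>. x [^] \<epsilon> x)"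
    using fin sub assms(2)
    by (intro finprod_mono_neutral_cong_right) (auto simp: \<epsilon>'_def subset_iff)
  then have "\<epsilon>' x = 0" if "x \<in> \<Lambda>" for x
    using \<epsilon> that by (intro dissociatedD[OF assms(1)]) (auto simp: \<epsilon>'_def)
  then show "\<forall>x\<in>\<Gamma>. \<epsilon> x = 0"
    using assms(2) by (force simp: \<epsilon>'_def)
qed

text \<open>The difference of the two indicator functions is an admissible exponent vector, and
  equality of the products forces it to vanish.\<close>

lemma dissociated_subset_prod_inj:
  assumes "dissociated G \<Lambda>" "S \<subseteq> \<Lambda>" "T \<subseteq> \<Lambda>" "(\<Otimes>x\<in>S. x) = (\<Otimes>x\<in>T. x)"
  shows "S = T"
proof -
  have fin: "finite \<Lambda>" and sub: "\<Lambda> \<subseteq> carrier G"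
    using assms(1) by (auto simp: dissociated_def)
  define \<epsilon> :: "'a \<Rightarrow> int" where "\<epsilon> = (\<lambda>x. of_bool (x \<in> S) - of_bool (x \<in> T))"
  have ind: "(\<Otimes>x\<in>\<Lambda>. if x \<in> R then x else \<one>) = (\<Otimes>x\<in>R. x)" if "R \<subseteq> \<Lambda>" for R
    using fin sub that by (intro finprod_mono_neutral_cong_right) auto
  \<comment> \<open>Multiplying by the indicator product of \<open>T\<close> turns each factor
    \<open>x [^] \<epsilon> x\<close> into the one for \<open>S\<close>; the product over
    \<open>T\<close> then cancels.\<close>
  have "(\<Otimes>x\<in>\<Lambda>. x [^] \<epsilon> x) \<otimes> (\<Otimes>x\<in>\<Lambda>. if x \<in> T then x else \<one>)
      = (\<Otimes>x\<in>\<Lambda>. x [^] \<epsilon> x \<otimes> (if x \<in> T then x else \<one>))"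
    using sub by (intro finprod_multf[symmetric]) auto
  also have "\<dots> = (\<Otimes>x\<in>\<Lambda>. if x \<in> S then x else \<one>)"
    using sub by (intro finprod_cong') (auto simp: \<epsilon>_def int_pow_neg)
  finally have "(\<Otimes>x\<in>\<Lambda>. x [^] \<epsilon> x) \<otimes> (\<Otimes>x\<in>T. x) = (\<Otimes>x\<in>T. x)"
    using ind assms by simp
  moreover have "(\<Otimes>x\<in>\<Lambda>. x [^] \<epsilon> x) \<in> carrier G" "(\<Otimes>x\<in>T. x) \<in> carrier G"
    using sub assms(3) by (auto intro!: finprod_closed)
  ultimately have "(\<Otimes>x\<in>\<Lambda>. x [^] \<epsilon> x) = \<one>"
    by simp
  then have "\<epsilon> x = 0" if "x \<in> \<Lambda>" for x
    using that by (intro dissociatedD[OF assms(1)]) (auto simp: \<epsilon>_def)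
  then show ?thesis
    using assms(2,3) by (force simp: \<epsilon>_def of_bool_def split: if_splits)
qed

lemma lprod_distinct:
  "distinct xs \<Longrightarrow> set xs \<subseteq> carrier G \<Longrightarrow> lprod xs = (\<Otimes>x\<in>set xs. x)"
  by (induction xs) (auto simp: subset_iff Pi_def)

text \<open>
  To bound the norm of all \<open>p\<close>-tuples from a dissociated set, entries are moved one by one from the
  first component to the second. The leading entry either differs from all the others and can be
  moved, or it equals one of the others, and then deleting both costs a factor \<open>n |\<Lambda>|\<close> only.
  In the end all entries are distinct, and the product determines their set.
\<close>

definition semi_distinct :: "'a set \<Rightarrow> nat \<Rightarrow> nat \<Rightarrow> ('a list \<times> 'a list) set" where
  "semi_distinct \<Lambda> n j = {(as, bs). length as = n \<and> length bs = j \<and> set as \<subseteq> \<Lambda> \<and> set bs \<subseteq> \<Lambda> \<and>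
     distinct bs \<and> set as \<inter> set bs = {}}"

definition lprod_pair :: "'a list \<times> 'a list \<Rightarrow> 'a" where
  "lprod_pair z = lprod (fst z) \<otimes> lprod (snd z)"

lemma finite_semi_distinct:
  assumes "finite \<Lambda>"
  shows "finite (semi_distinct \<Lambda> n j)"
  by (rule finite_subset[of _ "{as. set as \<subseteq> \<Lambda> \<and> length as = n} \<times> {bs. set bs \<subseteq> \<Lambda> \<and> length bs = j}"])
     (auto simp: semi_distinct_def assms finite_lists_length_eq)

text \<open>Equal products force equal sets of entries, so a list \<open>bs\<close> has at most
  \<open>j ^ j\<close> partners, all written with its own entries. The cruder bound
  \<open>p ^ j\<close> has a base that stays fixed while \<open>j\<close> varies.\<close>

lemma fibre_norm_semi_distinct_0:
  assumes "dissociated G \<Lambda>" "j \<le> p"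
  shows "fibre_norm (semi_distinct \<Lambda> 0 j) lprod_pair \<le> sqrt (real p * real (card \<Lambda>)) ^ j"
proof -
  have fin: "finite \<Lambda>" and sub: "\<Lambda> \<subseteq> carrier G"
    using assms(1) by (auto simp: dissociated_def)
  let ?X = "semi_distinct \<Lambda> 0 j"
  let ?L = "\<lambda>S. {bs. set bs \<subseteq> S \<and> length bs = j}"
  have "card {z \<in> ?X \<times> ?X. lprod_pair (fst z) = lprod_pair (snd z)} \<le> card (SIGMA bs:?L \<Lambda>. ?L (set bs))"
  proof (rule card_inj_on_le[where f = "map_prod snd snd"])
    show "inj_on (map_prod snd snd) {z \<in> ?X \<times> ?X. lprod_pair (fst z) = lprod_pair (snd z)}"
      by (auto simp: inj_on_def semi_distinct_def)
    show "finite (SIGMA bs:?L \<Lambda>. ?L (set bs))"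
      using fin by (intro finite_SigmaI finite_lists_length_eq) auto
    have "set bs = set cs" if "(as, bs) \<in> ?X" "(as', cs) \<in> ?X" "lprod_pair (as, bs) = lprod_pair (as', cs)"
      for as as' bs cs
    proof (rule dissociated_subset_prod_inj[OF assms(1)])
      have "set bs \<subseteq> carrier G" "set cs \<subseteq> carrier G"
        using that sub by (auto simp: semi_distinct_def)
      then show "(\<Otimes>x\<in>set bs. x) = (\<Otimes>x\<in>set cs. x)"
        using that lprod_closed[of bs] lprod_closed[of cs]
        by (auto simp: semi_distinct_def lprod_pair_def lprod_distinct[symmetric])
    qed (use that in \<open>auto simp: semi_distinct_def\<close>)
    note same_set = this
    show "map_prod snd snd ` {z \<in> ?X \<times> ?X. lprod_pair (fst z) = lprod_pair (snd z)}
        \<subseteq> (SIGMA bs:?L \<Lambda>. ?L (set bs))"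
    proof (rule image_subsetI)
      fix q assume q: "q \<in> {z \<in> ?X \<times> ?X. lprod_pair (fst z) = lprod_pair (snd z)}"
      obtain as bs as' cs where q': "q = ((as, bs), (as', cs))"
        by (metis surj_pair)
      have X: "(as, bs) \<in> ?X" "(as', cs) \<in> ?X" "lprod_pair (as, bs) = lprod_pair (as', cs)"
        using q by (simp_all add: q')
      have "set bs = set cs" by (rule same_set[OF X])
      moreover have "bs \<in> ?L \<Lambda>" "length cs = j"
        using X(1,2) by (simp_all add: semi_distinct_def)
      ultimately show "map_prod snd snd q \<in> (SIGMA bs:?L \<Lambda>. ?L (set bs))"
        by (simp add: q')
    qed
  qed
  also have "\<dots> = (\<Sum>bs\<in>?L \<Lambda>. card (set bs) ^ j)"
    using fin by (subst card_SigmaI) (auto simp: finite_lists_length_eq card_lists_length_eq)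
  also have "\<dots> \<le> (\<Sum>bs\<in>?L \<Lambda>. p ^ j)"
    using assms(2) by (intro sum_mono power_mono) (auto intro: order_trans[OF card_length])
  also have "\<dots> = (p * card \<Lambda>) ^ j"
    using fin by (simp add: card_lists_length_eq power_mult_distrib mult.commute)
  finally have "coincidences ?X lprod_pair ?X lprod_pair \<le> real ((p * card \<Lambda>) ^ j)"
    unfolding coincidences_def of_nat_le_iff .
  then have "fibre_norm ?X lprod_pair \<le> sqrt ((real p * real (card \<Lambda>)) ^ j)"
    unfolding fibre_norm_def by (intro real_sqrt_le_mono) simp
  then show ?thesis by (simp add: real_sqrt_power)
qed

text \<open>Either the head of the first list does not recur there and moves to the second list, or
  it is some \<open>a\<close> recurring at some position \<open>i\<close>, which gives
  \<open>m * card \<Lambda>\<close> further pieces. For \<open>m = 0\<close> the term with the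
  truncated \<open>m - 1\<close> is multiplied by zero.\<close>

lemma fibre_norm_semi_distinct_Suc:
  assumes fin: "finite \<Lambda>" and sub: "\<Lambda> \<subseteq> carrier G"
  shows "fibre_norm (semi_distinct \<Lambda> (Suc m) j) lprod_pair
    \<le> fibre_norm (semi_distinct \<Lambda> m (Suc j)) lprod_pair
      + real m * real (card \<Lambda>) * fibre_norm (semi_distinct \<Lambda> (m - 1) j) lprod_pair"
proof -
  let ?X = "semi_distinct \<Lambda> (Suc m) j"
  define F where "F = case_option {(as, bs) \<in> ?X. hd as \<notin> set (tl as)}
    (\<lambda>(a, i). {(as, bs) \<in> ?X. hd as = a \<and> tl as ! i = a})"
  let ?I = "insert None (Some ` (\<Lambda> \<times> {..<m}))"
  have "fibre_norm ?X lprod_pair \<le> (\<Sum>i\<in>?I. fibre_norm (F i) lprod_pair)"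
  proof (rule fibre_norm_cover)
    show "finite (F i)" for i
      by (rule finite_subset[OF _ finite_semi_distinct[OF fin, of "Suc m" j]])
         (auto simp: F_def split: option.splits)
    show "?X \<subseteq> (\<Union>i\<in>?I. F i)"
    proof
      fix z assume z: "z \<in> ?X"
      obtain a as bs where z': "z = (a # as, bs)" "length as = m" "a \<in> \<Lambda>"
        using z by (auto simp: semi_distinct_def length_Suc_conv)
      show "z \<in> (\<Union>i\<in>?I. F i)"
      proof (cases "a \<in> set as")
        case True
        then obtain i where "i < m" "as ! i = a" using z' by (auto simp: in_set_conv_nth)
        then have "z \<in> F (Some (a, i))" "Some (a, i) \<in> ?I" using z z' by (auto simp: F_def)
        then show ?thesis by blast
      next
        case False
        then have "z \<in> F None" using z z' by (auto simp: F_def)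
        then show ?thesis by blast
      qed
    qed
  qed (use fin in auto)
  also have "\<dots> = fibre_norm (F None) lprod_pair + (\<Sum>i\<in>\<Lambda> \<times> {..<m}. fibre_norm (F (Some i)) lprod_pair)"
    using fin by (subst sum.insert) (auto simp: sum.reindex)
  also have "\<dots> \<le> fibre_norm (semi_distinct \<Lambda> m (Suc j)) lprod_pair
      + (\<Sum>i\<in>\<Lambda> \<times> {..<m}. fibre_norm (semi_distinct \<Lambda> (m - 1) j) lprod_pair)"
  proof (intro add_mono sum_mono)
    \<comment> \<open>The second list stays distinct because the two lists have no common entry;
      they stay disjoint because the head does not recur.\<close>
    let ?h = "\<lambda>(as, bs). (tl as, hd as # bs)"
    have eq: "lprod_pair (?h z) = lprod_pair z" if z: "z \<in> F None" for z
    proof -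
      obtain a as bs where z': "z = (a # as, bs)"
        using z by (auto simp: F_def semi_distinct_def length_Suc_conv)
      have "a \<in> \<Lambda>" "set as \<subseteq> \<Lambda>" "set bs \<subseteq> \<Lambda>"
        using z by (auto simp: z' F_def semi_distinct_def)
      then have "a \<in> carrier G" "lprod as \<in> carrier G" "lprod bs \<in> carrier G"
        using sub by auto
      then show ?thesis by (simp add: z' lprod_pair_def m_ac)
    qed
    show "fibre_norm (F None) lprod_pair \<le> fibre_norm (semi_distinct \<Lambda> m (Suc j)) lprod_pair"
    proof (rule fibre_norm_inj_le[where h = ?h])
      show "inj_on ?h (F None)"
        by (rule inj_on_inverseI[where g = "\<lambda>(as, bs). (hd bs # as, tl bs)"])
           (auto simp: F_def semi_distinct_def length_Suc_conv)
      show "?h ` F None \<subseteq> semi_distinct \<Lambda> m (Suc j)"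
        by (auto simp: F_def semi_distinct_def length_Suc_conv)
    qed (simp_all add: eq finite_semi_distinct fin)
  next
    fix ai assume "ai \<in> \<Lambda> \<times> {..<m}"
    then obtain a i where ai: "ai = (a, i)" "a \<in> \<Lambda>" "i < m" by auto
    \<comment> \<open>Both occurrences of \<open>a\<close> are deleted. They can be restored because
      \<open>a\<close> and \<open>i\<close> are fixed on this piece, which makes the map
      injective.\<close>
    let ?h = "\<lambda>(as, bs). (take i (tl as) @ drop (Suc i) (tl as), bs)"
    let ?g = "\<lambda>(cs, bs). (a # take i cs @ a # drop i cs, bs)"
    have F: "\<exists>us vs bs. z = (a # us @ a # vs, bs) \<and> length us = i \<and> Suc (length us + length vs) = m \<and>
        length bs = j \<and> set us \<union> set vs \<union> set bs \<subseteq> \<Lambda> \<and> distinct bs \<and> (set us \<union> set vs) \<inter> set bs = {}"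
      if zF: "z \<in> F (Some ai)" for z
    proof -
      obtain as bs where z: "z = (a # as, bs)" "as ! i = a" "(a # as, bs) \<in> ?X" "length as = m"
        using zF ai by (auto simp: F_def semi_distinct_def length_Suc_conv)
      have "as = take i as @ a # drop (Suc i) as"
        using z ai by (metis id_take_nth_drop)
      then have "z = (a # take i as @ a # drop (Suc i) as, bs)"
        using z(1) by metis
      moreover have "set (take i as) \<subseteq> set as" "set (drop (Suc i) as) \<subseteq> set as"
        by (auto dest: in_set_takeD in_set_dropD)
      ultimately show ?thesis
        using z(3,4) ai
        by (intro exI[of _ "take i as"] exI[of _ "drop (Suc i) as"] exI[of _ bs])
           (auto simp: semi_distinct_def)
    qed
    show "fibre_norm (F (Some ai)) lprod_pair \<le> fibre_norm (semi_distinct \<Lambda> (m - 1) j) lprod_pair"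
    proof (rule fibre_norm_inj_le[where h = ?h])
      show "inj_on ?h (F (Some ai))"
        by (rule inj_on_inverseI[where g = ?g]) (auto dest!: F)
      show "?h ` F (Some ai) \<subseteq> semi_distinct \<Lambda> (m - 1) j"
        by (auto dest!: F simp: semi_distinct_def)
      have cl: "lprod_pair (?h z) \<in> carrier G \<and> lprod_pair z = (a \<otimes> a) \<otimes> lprod_pair (?h z)" if z: "z \<in> F (Some ai)" for z
      proof -
        obtain us vs bs where "z = (a # us @ a # vs, bs)" "length us = i"
          "set us \<subseteq> carrier G" "set vs \<subseteq> carrier G" "set bs \<subseteq> carrier G" "a \<in> carrier G"
          using F[OF z] ai sub by blast
        then show ?thesis by (simp add: lprod_pair_def lprod_append m_ac)
      qed
      fix x y assume xy: "x \<in> F (Some ai)" "y \<in> F (Some ai)" "lprod_pair x = lprod_pair y"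
      have "(a \<otimes> a) \<otimes> lprod_pair (?h x) = (a \<otimes> a) \<otimes> lprod_pair (?h y)"
        using cl[OF xy(1)] cl[OF xy(2)] xy(3) by argo
      moreover have "a \<otimes> a \<in> carrier G" using ai sub by auto
      ultimately show "lprod_pair (?h x) = lprod_pair (?h y)"
        using Units_l_cancel[of "a \<otimes> a" "lprod_pair (?h x)" "lprod_pair (?h y)"]
          cl[OF xy(1)] cl[OF xy(2)] unfolding Units_eq by blast
    qed (simp add: finite_semi_distinct fin)
  qed
  finally show ?thesis by (simp add: card_cartesian_product mult.commute)
qed

text \<open>Strong induction, as the recursion leads to \<open>n - 1\<close> and
  \<open>n - 2\<close>. Two deleted entries cost \<open>m * card \<Lambda>\<close>, at most
  \<open>p * card \<Lambda>\<close>, so both terms have the same bound and each step contributes a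
  factor 2.\<close>

lemma fibre_norm_semi_distinct_le:
  assumes "dissociated G \<Lambda>" "n + j \<le> p"
  shows "fibre_norm (semi_distinct \<Lambda> n j) lprod_pair \<le> 2 ^ n * sqrt (real p * real (card \<Lambda>)) ^ (n + j)"
  using assms(2)
proof (induction n arbitrary: j rule: less_induct)
  case (less n)
  have fin: "finite \<Lambda>" and sub: "\<Lambda> \<subseteq> carrier G"
    using assms(1) by (auto simp: dissociated_def)
  define s where "s = sqrt (real p * real (card \<Lambda>))"
  have s: "s \<ge> 0" "s ^ 2 = real p * real (card \<Lambda>)" by (auto simp: s_def)
  show ?case
  proof (cases n)
    case 0
    then show ?thesis using fibre_norm_semi_distinct_0[OF assms(1)] less.prems by simp
  next
    case (Suc m)
    have 1: "fibre_norm (semi_distinct \<Lambda> m (Suc j)) lprod_pair \<le> 2 ^ m * s ^ (n + j)"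
      using less.IH[of m "Suc j"] less.prems Suc by (simp add: s_def)
    have 2: "real m * real (card \<Lambda>) * fibre_norm (semi_distinct \<Lambda> (m - 1) j) lprod_pair \<le> 2 ^ m * s ^ (n + j)"
    proof (cases m)
      case 0
      then show ?thesis using s by simp
    next
      case (Suc l)
      have "real m * real (card \<Lambda>) \<le> s ^ 2"
        unfolding s(2) using less.prems \<open>n = Suc m\<close> by (intro mult_right_mono) auto
      moreover have "fibre_norm (semi_distinct \<Lambda> (m - 1) j) lprod_pair \<le> 2 ^ m * s ^ (l + j)"
      proof -
        have "fibre_norm (semi_distinct \<Lambda> l j) lprod_pair \<le> 2 ^ l * s ^ (l + j)"
          using less.IH[of l j] less.prems Suc \<open>n = Suc m\<close> by (simp add: s_def)
        also have "\<dots> \<le> 2 ^ m * s ^ (l + j)"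
          using Suc s by (intro mult_right_mono power_increasing) auto
        finally show ?thesis using Suc by simp
      qed
      ultimately have "real m * real (card \<Lambda>) * fibre_norm (semi_distinct \<Lambda> (m - 1) j) lprod_pair
          \<le> s ^ 2 * (2 ^ m * s ^ (l + j))"
        using fibre_norm_nonneg by (intro mult_mono) auto
      also have "\<dots> = 2 ^ m * s ^ (n + j)"
        using Suc \<open>n = Suc m\<close> by (simp add: power2_eq_square)
      finally show ?thesis .
    qed
    show ?thesis
      using fibre_norm_semi_distinct_Suc[OF fin sub, of m j] 1 2 Suc by (simp add: s_def)
  qed
qed

text \<open>Rudin's inequality, in combinatorial form.\<close>

lemma tuple_energy_dissociated_le:
  assumes "dissociated G \<Lambda>"
  shows "tuple_energy (replicate p \<Lambda>) \<le> (4 * real p * real (card \<Lambda>)) ^ p"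
proof -
  have fin: "finite \<Lambda>" and sub: "\<Lambda> \<subseteq> carrier G"
    using assms(1) by (auto simp: dissociated_def)
  let ?t = "tuples (replicate p \<Lambda>)"
  have "fibre_norm ?t lprod \<le> fibre_norm (semi_distinct \<Lambda> p 0) lprod_pair"
  proof (rule fibre_norm_inj_le[where h = "\<lambda>as. (as, [] :: 'a list)"])
    fix x y assume "x \<in> ?t" "y \<in> ?t" "lprod x = lprod y"
    then show "lprod_pair (x, []) = lprod_pair (y, [])" by (simp add: lprod_pair_def)
  next
    show "(\<lambda>as. (as, [] :: 'a list)) ` ?t \<subseteq> semi_distinct \<Lambda> p 0"
      by (auto simp: semi_distinct_def tuples_replicate)
    show "inj_on (\<lambda>as. (as, [] :: 'a list)) ?t" by (simp add: inj_on_def)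
  qed (simp add: finite_semi_distinct fin)
  also have "\<dots> \<le> 2 ^ p * sqrt (real p * real (card \<Lambda>)) ^ p"
    using fibre_norm_semi_distinct_le[OF assms, of p 0 p] by simp
  finally have "tuple_energy (replicate p \<Lambda>) \<le> (2 ^ p * sqrt (real p * real (card \<Lambda>)) ^ p) ^ 2"
    unfolding tuple_energy_eq_fibre_norm by (intro power_mono fibre_norm_nonneg)
  also have "\<dots> = ((2 * sqrt (real p * real (card \<Lambda>))) ^ 2) ^ p"
    by (simp only: power_mult_distrib power_mult[symmetric] mult.commute)
  also have "(2 * sqrt (real p * real (card \<Lambda>))) ^ 2 = 4 * real p * real (card \<Lambda>)"
    by (simp add: power_mult_distrib)
  finally show ?thesis .
qed

end

section \<open>Passage from indexed products to lists, and first bounds on energies\<close>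

lemma coincidences_mono: "finite X \<Longrightarrow> finite Y' \<Longrightarrow> Y \<subseteq> Y' \<Longrightarrow> coincidences X \<phi> Y \<psi> \<le> coincidences X \<phi> Y' \<psi>"
  unfolding coincidences_def of_nat_le_iff by (rule card_mono) auto

lemma coincidences_Un_le: "coincidences X \<phi> (Y \<union> Z) \<psi> \<le> coincidences X \<phi> Y \<psi> + coincidences X \<phi> Z \<psi>"
proof -
  have "{z \<in> X \<times> (Y \<union> Z). \<phi> (fst z) = \<psi> (snd z)}
      = {z \<in> X \<times> Y. \<phi> (fst z) = \<psi> (snd z)} \<union> {z \<in> X \<times> Z. \<phi> (fst z) = \<psi> (snd z)}"
    by auto
  then show ?thesis
    unfolding coincidences_def of_nat_add[symmetric] of_nat_le_iff by (simp only: card_Un_le)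
qed

text \<open>The bridge from the extensional functions in \<open>add_energy\<close> to lists;
  distinct indices make every choice of entries realisable.\<close>

lemma bij_betw_PiE_tuples:
  assumes "distinct is"
  shows "bij_betw (\<lambda>a. map a is) (PiE (set is) As) (tuples (map As is))"
proof (rule bij_betw_imageI)
  show "inj_on (\<lambda>a. map a is) (PiE (set is) As)"
  proof (rule inj_onI)
    fix a b assume "a \<in> PiE (set is) As" "b \<in> PiE (set is) As" "map a is = map b is"
    then show "a = b" by (intro PiE_ext[of a "set is" As b]) auto
  qed
  show "(\<lambda>a. map a is) ` PiE (set is) As = tuples (map As is)"
    using assms
  proof (induction "is")
    case (Cons i "is")
    have "\<exists>a \<in> PiE (set (i # is)) As. map a (i # is) = x # xs"
      if x: "x \<in> As i" and xs: "xs \<in> tuples (map As is)" for x xs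
    proof -
      have "xs \<in> (\<lambda>a. map a is) ` PiE (set is) As"
        using Cons xs by simp
      then obtain a where a: "a \<in> PiE (set is) As" "map a is = xs"
        by blast
      have "map (a(i := x)) (i # is) = x # xs"
        using a Cons.prems by auto
      moreover have "a(i := x) \<in> PiE (set (i # is)) As"
        using PiE_fun_upd[of x As i a "set is"] a(1) x by simp
      ultimately show ?thesis by (rule bexI)
    qed
    note ex = this
    have "tuples (map As (i # is)) \<subseteq> (\<lambda>a. map a (i # is)) ` PiE (set (i # is)) As"
    proof
      fix ys assume "ys \<in> tuples (map As (i # is))"
      then obtain x xs where "ys = x # xs" "x \<in> As i" "xs \<in> tuples (map As is)"
        by (auto simp: tuples_Cons)
      with ex[of x xs] show "ys \<in> (\<lambda>a. map a (i # is)) ` PiE (set (i # is)) As"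
        unfolding image_iff by metis
    qed
    moreover have "(\<lambda>a. map a js) ` PiE (set js) As \<subseteq> tuples (map As js)" for js
      by (auto simp: tuples_def list_all2_conv_all_nth PiE_iff)
    ultimately show ?case by blast
  qed simp
qed

context comm_group
begin

lemma lprod_map:
  "distinct is \<Longrightarrow> a \<in> set is \<rightarrow> carrier G \<Longrightarrow> lprod (map a is) = (\<Otimes>i\<in>set is. a i)"
  by (induction "is") (auto simp: Pi_def)

text \<open>A function on \<open>{1..2 * k}\<close> corresponds to its two halves. The second half
  is read backwards so that the last two arguments, later the special ones, head their list.\<close>

lemma add_energy_eq_coincidences:
  assumes "\<And>i. As i \<subseteq> carrier G"
  shows "real (add_energy G k As)
    = coincidences (tuples (map As [1..<k + 1])) lprod (tuples (map As (rev [k + 1..<2 * k + 1]))) lprod"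
proof -
  define I where "I = [1..<k + 1]"
  define J where "J = rev [k + 1..<2 * k + 1]"
  have IJ: "set I = {1..k}" "set J = {k + 1..2 * k}" "distinct (I @ J)" "set (I @ J) = {1..2 * k}"
    by (auto simp: I_def J_def)
  let ?P = "PiE {1..2 * k} As"
  let ?f = "\<lambda>a. (map a I, map a J)"
  have bij: "bij_betw (\<lambda>a. map a (I @ J)) ?P (tuples (map As (I @ J)))"
    using bij_betw_PiE_tuples[OF IJ(3), of As] IJ(4) by simp
  have inj: "inj_on ?f ?P"
    using bij by (auto simp: bij_betw_def inj_on_def)
  have prods: "lprod (map a I) = (\<Otimes>i\<in>{1..k}. a i)" "lprod (map a J) = (\<Otimes>i\<in>{k + 1..2 * k}. a i)"
    if "a \<in> ?P" for a
  proof -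
    have "a i \<in> carrier G" if "i \<in> {1..2 * k}" for i
      using PiE_mem[OF \<open>a \<in> ?P\<close> that] assms[of i] by blast
    then show "lprod (map a I) = (\<Otimes>i\<in>{1..k}. a i)" "lprod (map a J) = (\<Otimes>i\<in>{k + 1..2 * k}. a i)"
      using IJ(3) by (simp_all add: lprod_map IJ(1,2) Pi_def)
  qed
  have im: "?f ` ?P = tuples (map As I) \<times> tuples (map As J)"
  proof
    show "?f ` ?P \<subseteq> tuples (map As I) \<times> tuples (map As J)"
    proof (rule image_subsetI)
      fix a assume "a \<in> ?P"
      moreover have "set I \<subseteq> {1..2 * k}" "set J \<subseteq> {1..2 * k}"
        using IJ(4) by auto
      ultimately have "\<forall>i\<in>set I. a i \<in> As i" "\<forall>i\<in>set J. a i \<in> As i"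
        by (blast dest: PiE_mem)+
      then show "?f a \<in> tuples (map As I) \<times> tuples (map As J)"
        by (simp add: tuples_def list_all2_conv_all_nth)
    qed
    show "tuples (map As I) \<times> tuples (map As J) \<subseteq> ?f ` ?P"
    proof clarify
      fix xs ys assume xy: "xs \<in> tuples (map As I)" "ys \<in> tuples (map As J)"
      then have "xs @ ys \<in> tuples (map As (I @ J))"
        by (auto simp: tuples_def intro: list_all2_appendI)
      then have "xs @ ys \<in> (\<lambda>a. map a (I @ J)) ` ?P"
        unfolding bij_betw_imp_surj_on[OF bij] .
      then obtain a where a: "a \<in> ?P" "map a (I @ J) = xs @ ys"
        unfolding image_iff by metis
      moreover have "length xs = length I"
        using xy(1) by (auto simp: tuples_def dest: list_all2_lengthD)
      ultimately have "?f a = (xs, ys)" by simp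
      then show "(xs, ys) \<in> ?f ` ?P" by (rule image_eqI[OF sym a(1)])
    qed
  qed
  have "{z \<in> tuples (map As I) \<times> tuples (map As J). lprod (fst z) = lprod (snd z)}
      = ?f ` {a \<in> ?P. (\<Otimes>i\<in>{1..k}. a i) = (\<Otimes>i\<in>{k + 1..2 * k}. a i)}"
    unfolding im[symmetric] using prods by auto
  moreover have "inj_on ?f {a \<in> ?P. (\<Otimes>i\<in>{1..k}. a i) = (\<Otimes>i\<in>{k + 1..2 * k}. a i)}"
    using inj by (rule inj_on_subset) auto
  ultimately show ?thesis
    unfolding coincidences_def add_energy_def I_def[symmetric] J_def[symmetric] by (simp add: card_image)
qed

lemma energy_eq_tuple_energy:
  assumes "A \<subseteq> carrier G"
  shows "real (energy G k A) = tuple_energy (replicate k A)"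
  using add_energy_eq_coincidences[of "\<lambda>_. A" k] assms
  by (simp add: tuple_energy_def map_replicate_const del: upt_Suc)

lemma add_energy_last_two:
  assumes "A \<subseteq> carrier G" "A' \<subseteq> A" "k \<ge> 2"
  shows "real (add_energy G k (\<lambda>i. if i \<le> 2 * k - 2 then A else A'))
    = coincidences (tuples (replicate k A)) lprod (tuples (A' # A' # replicate (k - 2) A)) lprod"
proof -
  let ?As = "\<lambda>i. if i \<le> 2 * k - 2 then A else A'"
  obtain m where k: "k = m + 2" using assms(3) by (metis add.commute le_Suc_ex)
  have "map ?As [1..<k + 1] = map (\<lambda>_. A) [1..<k + 1]"
    using assms(3) by (intro map_cong) auto
  then have 1: "map ?As [1..<k + 1] = replicate k A"
    by (simp add: map_replicate_const del: upt_Suc)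
  have "rev [k + 1..<2 * k + 1] = 2 * k # (2 * k - 1) # rev [k + 1..<2 * k - 1]"
    unfolding k by (simp add: upt_Suc_append)
  moreover have "map ?As (rev [k + 1..<2 * k - 1]) = map (\<lambda>_. A) (rev [k + 1..<2 * k - 1])"
    by (intro map_cong) auto
  ultimately have 2: "map ?As (rev [k + 1..<2 * k + 1]) = A' # A' # replicate (k - 2) A"
    using assms(3) by (simp add: map_replicate_const k del: upt_Suc)
  have "?As i \<subseteq> carrier G" for i using assms by auto
  from add_energy_eq_coincidences[of ?As k, OF this] show ?thesis unfolding 1 2 .
qed

lemma tuple_energy_singleton_le:
  assumes "finite A" "A \<subseteq> carrier G"
  shows "tuple_energy [A] \<le> card A"
proof -
  have "card {z \<in> tuples [A] \<times> tuples [A]. lprod (fst z) = lprod (snd z)} \<le> card A"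
    by (rule card_inj_on_le[where f = "hd \<circ> fst"])
       (use assms in \<open>auto simp: inj_on_def tuples_Cons subset_iff\<close>)
  then show ?thesis by (simp add: tuple_energy_def coincidences_def)
qed

text \<open>Each of the first \<open>n\<close> factors costs \<open>card A ^ 2\<close>; for the
  remaining one the two entries must agree.\<close>

lemma tuple_energy_replicate_card_le:
  assumes "finite A" "A \<subseteq> carrier G"
  shows "tuple_energy (replicate (Suc n) A) \<le> real (card A) ^ (2 * n + 1)"
proof -
  have "tuple_energy (replicate (Suc n) A) = tuple_energy (replicate n A @ [A])"
    by (simp add: replicate_append_same)
  also have "\<dots> \<le> real (card A) ^ (2 * n) * tuple_energy [A]"
    using assms by (intro tuple_energy_replicate_le) auto
  also have "\<dots> \<le> real (card A) ^ (2 * n) * card A"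
    using tuple_energy_singleton_le[OF assms] by (intro mult_left_mono) auto
  finally show ?thesis by (simp add: mult.commute)
qed

text \<open>Interpolation between \<open>{\<one>}\<close> and \<open>\<Lambda>\<close> in
  \<open>p\<close> positions leads to \<open>p\<close> copies of \<open>\<Lambda>\<close>. There the
  copies of \<open>A\<close> are dropped trivially and Rudin's inequality applies. The condition on
  \<open>p\<close> limits the loss to \<open>2 ^ p\<close>, a factor 2 after taking roots, whence 8
  = 2 * 4.\<close>

lemma tuple_energy_dissociated_Cons_le:
  assumes A: "finite A" "A \<subseteq> carrier G" "A \<noteq> {}" and \<Lambda>: "dissociated G \<Lambda>" "\<Lambda> \<noteq> {}"
    and p: "p \<ge> 1" "real (card A) ^ (2 * n) \<le> 2 ^ p * tuple_energy (replicate n A)"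
  shows "tuple_energy (\<Lambda> # replicate n A) \<le> 8 * real p * real (card \<Lambda>) * tuple_energy (replicate n A)"
proof -
  have L: "finite \<Lambda>" "\<Lambda> \<subseteq> carrier G" using \<Lambda> by (auto simp: dissociated_def)
  let ?Z = "replicate n A"
  have Z: "set ?Z \<subseteq> fin_subsets" "set (\<Lambda> # ?Z) \<subseteq> fin_subsets" "\<forall>S\<in>set ?Z. S \<noteq> {}"
    using A L by auto
  have "tuple_energy (\<Lambda> # replicate (p - 1) {\<one>} @ ?Z) = tuple_energy (replicate (p - 1) {\<one>} @ \<Lambda> # ?Z)"
    using A L by (intro tuple_energy_mset_cong) auto
  also have "\<dots> = tuple_energy (\<Lambda> # ?Z)" by (rule tuple_energy_replicate_one[OF Z(2)])
  finally have "tuple_energy (\<Lambda> # ?Z) ^ p = tuple_energy (\<Lambda> # replicate (p - 1) {\<one>} @ ?Z) ^ p" by simp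
  also have "\<dots> \<le> tuple_energy (replicate p {\<one>} @ ?Z) ^ (p - 1) * tuple_energy (replicate p \<Lambda> @ ?Z)"
    using L \<Lambda>(2) Z(1,3) p(1) by (intro tuple_energy_interpolate) auto
  also have "tuple_energy (replicate p {\<one>} @ ?Z) = tuple_energy ?Z" by (rule tuple_energy_replicate_one[OF Z(1)])
  also have "tuple_energy (replicate p \<Lambda> @ ?Z) = tuple_energy (?Z @ replicate p \<Lambda>)"
    using A L by (intro tuple_energy_mset_cong) auto
  also have "\<dots> \<le> real (card A) ^ (2 * n) * tuple_energy (replicate p \<Lambda>)"
    using A L by (intro tuple_energy_replicate_le) auto
  also have "\<dots> \<le> (2 ^ p * tuple_energy ?Z) * (4 * real p * real (card \<Lambda>)) ^ p"
    using p(2) tuple_energy_dissociated_le[OF \<Lambda>(1)] by (intro mult_mono tuple_energy_nonneg) (auto simp: tuple_energy_nonneg)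
  finally have "tuple_energy (\<Lambda> # ?Z) ^ p
      \<le> tuple_energy ?Z ^ (p - 1) * ((2 ^ p * tuple_energy ?Z) * (4 * real p * real (card \<Lambda>)) ^ p)"
    by (simp add: tuple_energy_nonneg mult_left_mono)
  also have "\<dots> = tuple_energy ?Z ^ p * (2 * (4 * real p * real (card \<Lambda>))) ^ p"
    using p(1) by (cases p) (simp_all add: power_mult_distrib)
  also have "\<dots> = (8 * real p * real (card \<Lambda>) * tuple_energy ?Z) ^ p"
    unfolding power_mult_distrib[symmetric] by (simp only: mult_ac) simp
  finally show ?thesis
    using p(1) tuple_energy_nonneg[of ?Z] tuple_energy_nonneg[of "\<Lambda> # ?Z"] by (subst (asm) power_mono_iff) auto
qed

section \<open>Removing dissociated sets\<close>

text \<open>Greedy removal. Each removed set is trimmed to exactly \<open>d\<close> elements, so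
  that there are at most \<open>card A / d\<close> of them and all obey the same energy
  bound.\<close>

lemma exhaust_dissociated:
  assumes "finite A" "d \<ge> 1"
  shows "\<exists>A' \<D>. A' \<subseteq> A \<and> finite \<D> \<and> \<Union>\<D> = A - A' \<and> d * card \<D> \<le> card A \<and>
    (\<forall>\<Lambda>\<in>\<D>. dissociated G \<Lambda> \<and> card \<Lambda> = d) \<and> (\<forall>\<Lambda>\<subseteq>A'. dissociated G \<Lambda> \<longrightarrow> card \<Lambda> < d)"
  using assms(1)
proof (induction rule: finite_psubset_induct)
  case (psubset A)
  show ?case
  proof (cases "\<exists>\<Lambda>\<subseteq>A. dissociated G \<Lambda> \<and> d \<le> card \<Lambda>")
    case False
    then show ?thesis by (intro exI[of _ A] exI[of _ "{}"]) (auto simp: not_le)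
  next
    case True
    then obtain \<Lambda>' where "\<Lambda>' \<subseteq> A" "dissociated G \<Lambda>'" "d \<le> card \<Lambda>'" by blast
    then obtain \<Lambda> where \<Lambda>: "\<Lambda> \<subseteq> A" "dissociated G \<Lambda>" "card \<Lambda> = d"
      by (meson dissociated_mono obtain_subset_with_card_n order_trans)
    then have "\<Lambda> \<noteq> {}" using assms(2) by auto
    then have "A - \<Lambda> \<subset> A" using \<Lambda>(1) by blast
    from psubset.IH[OF this] obtain A' \<D> where
      IH: "A' \<subseteq> A - \<Lambda>" "finite \<D>" "\<Union>\<D> = A - \<Lambda> - A'" "d * card \<D> \<le> card (A - \<Lambda>)"
        "\<forall>\<Lambda>\<in>\<D>. dissociated G \<Lambda> \<and> card \<Lambda> = d" "\<forall>\<Lambda>\<subseteq>A'. dissociated G \<Lambda> \<longrightarrow> card \<Lambda> < d"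
      by blast
    have "card (A - \<Lambda>) + d = card A"
      using \<Lambda> psubset.hyps finite_subset[OF \<Lambda>(1)] card_mono[of A \<Lambda>] by (simp add: card_Diff_subset)
    moreover have "card (insert \<Lambda> \<D>) \<le> Suc (card \<D>)" using IH(2) by (simp add: card_insert_le_m1)
    then have "d * card (insert \<Lambda> \<D>) \<le> d * Suc (card \<D>)" by (intro mult_left_mono) auto
    ultimately have "d * card (insert \<Lambda> \<D>) \<le> card A" using IH(4) by simp
    moreover have "\<Union>(insert \<Lambda> \<D>) = A - A'" using IH(1,3) \<Lambda>(1) by auto
    ultimately show ?thesis
      using IH \<Lambda> by (intro exI[of _ A'] exI[of _ "insert \<Lambda> \<D>"]) auto
  qed
qed

lemma diss_dim_le:
  assumes "finite B" "\<And>\<Lambda>. \<Lambda> \<subseteq> B \<Longrightarrow> dissociated G \<Lambda> \<Longrightarrow> card \<Lambda> \<le> d"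
  shows "diss_dim G B \<le> d"
proof -
  have "{card \<Lambda> | \<Lambda>. \<Lambda> \<subseteq> B \<and> dissociated G \<Lambda>} \<subseteq> card ` Pow B" by auto
  then have "finite {card \<Lambda> | \<Lambda>. \<Lambda> \<subseteq> B \<and> dissociated G \<Lambda>}"
    by (rule finite_subset) (simp add: assms(1))
  moreover have "{card \<Lambda> | \<Lambda>. \<Lambda> \<subseteq> B \<and> dissociated G \<Lambda>} \<noteq> {}"
    by (auto simp: dissociated_def intro!: exI[of _ "{}"])
  ultimately show ?thesis
    unfolding diss_dim_def using assms(2) by (subst Max_le_iff) auto
qed

text \<open>The exponent 1 at the identity is a nontrivial relation. This settles
  \<open>A = {\<one>}\<close>, where the logarithm vanishes.\<close>

lemma not_dissociated_one: "\<one> \<in> \<Lambda> \<Longrightarrow> \<not> dissociated G \<Lambda>"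
proof
  assume "\<one> \<in> \<Lambda>" "dissociated G \<Lambda>"
  then have "dissociated G {\<one>}" using dissociated_mono by auto
  from dissociatedD[OF this, of "\<lambda>_. 1" \<one>] show False by simp
qed

text \<open>If the first two entries are not both in \<open>A'\<close>, one of them is in
  \<open>A - A'\<close>. By symmetry and Cauchy-Schwarz each of the two cases loses at most the
  square root.\<close>

lemma coincidences_last_two_ge:
  assumes A: "finite A" "A \<subseteq> carrier G" "A' \<subseteq> A" "k \<ge> 2"
  shows "coincidences (tuples (replicate k A)) lprod (tuples (A' # A' # replicate (k - 2) A)) lprod
    \<ge> tuple_energy (replicate k A) - 2 * sqrt (tuple_energy (replicate k A) * tuple_energy ((A - A') # replicate (k - 1) A))"
proof -
  let ?R = "replicate (k - 2) A" and ?B = "A - A'"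
  let ?X = "tuples (replicate k A)"
  have r: "replicate k A = A # A # ?R" "replicate (k - 1) A = A # ?R"
    using A(4) by (auto simp flip: replicate_Suc simp: Suc_diff_Suc)
  have fin: "finite (tuples (C # D # ?R))" if "C \<subseteq> A" "D \<subseteq> A" for C D
    using A that by (intro finite_tuples) (auto intro: finite_subset)
  have CS: "coincidences ?X lprod (tuples (C # D # ?R)) lprod \<le> sqrt (tuple_energy (replicate k A) * tuple_energy (C # D # ?R))"
    if "C \<subseteq> A" "D \<subseteq> A" for C D
    using coincidences_Cauchy_Schwarz[of ?X "tuples (C # D # ?R)" lprod lprod] fin that
    by (simp add: r fibre_norm_def tuple_energy_def real_sqrt_mult)
  have "tuple_energy (A # ?B # ?R) = tuple_energy (?B # A # ?R)"
    using A by (intro tuple_energy_mset_cong) auto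
  then have B: "coincidences ?X lprod (tuples (A # ?B # ?R)) lprod \<le> sqrt (tuple_energy (replicate k A) * tuple_energy (?B # A # ?R))"
    using CS[of A ?B] by auto
  have "?X \<subseteq> tuples (A' # A' # ?R) \<union> (tuples (?B # A # ?R) \<union> tuples (A # ?B # ?R))"
  proof
    fix xs assume "xs \<in> ?X"
    then obtain a b ys where "xs = a # b # ys" "a \<in> A" "b \<in> A" "ys \<in> tuples ?R"
      unfolding r by (auto simp: tuples_Cons)
    then show "xs \<in> tuples (A' # A' # ?R) \<union> (tuples (?B # A # ?R) \<union> tuples (A # ?B # ?R))"
      by auto
  qed
  then have "tuple_energy (replicate k A) \<le> coincidences ?X lprod (tuples (A' # A' # ?R) \<union> (tuples (?B # A # ?R) \<union> tuples (A # ?B # ?R))) lprod"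
    unfolding tuple_energy_def using fin A(3) r(1) by (intro coincidences_mono) auto
  also have "\<dots> \<le> coincidences ?X lprod (tuples (A' # A' # ?R)) lprod
      + (coincidences ?X lprod (tuples (?B # A # ?R)) lprod + coincidences ?X lprod (tuples (A # ?B # ?R)) lprod)"
    by (intro order_trans[OF coincidences_Un_le] add_left_mono coincidences_Un_le)
  finally show ?thesis using B CS[OF Diff_subset subset_refl, of A'] unfolding r(2) by linarith
qed

text \<open>By the triangle inequality over \<open>\<D>\<close> the energy \<open>S\<close> of the
  removed part is at most quadratic in \<open>card \<D>\<close>, and
  \<open>d * card \<D> \<le> card A\<close> turns this into a bound proportional to
  \<open>1 / d\<close>. So a large \<open>d\<close> makes the loss small, while \<open>d\<close>
  also bounds the dimension.\<close>

lemma exists_small_dim_subset: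
  assumes A: "finite A" "A \<subseteq> carrier G" "card A \<ge> 2" and k: "k \<ge> 2"
  defines "a \<equiv> real (card A)" and "T \<equiv> tuple_energy (replicate k A)" and "T' \<equiv> tuple_energy (replicate (k - 1) A)"
  shows "\<exists>A' \<subseteq> A.
    coincidences (tuples (replicate k A)) lprod (tuples (A' # A' # replicate (k - 2) A)) lprod \<ge> T / 2 \<and>
    real (diss_dim G A') \<le> 258 * (T' * a ^ 2 / T) * log 2 (a ^ (2 * k) / T)"
proof -
  have a: "a \<ge> 2" using A(3) by (simp add: a_def)
  have ne: "A \<noteq> {}" using A(3) by auto
  have fs: "set (replicate n A) \<subseteq> fin_subsets" for n using A by auto
  have T: "T > 0" "T' > 0" unfolding T_def T'_def using A ne by (auto intro!: tuple_energy_pos)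
  have rk: "replicate k A = A # replicate (k - 1) A" "k = Suc (k - 1)"
    using k by (cases k; simp)+
  have "T \<le> a ^ (2 * (k - 1) + 1)"
    using tuple_energy_replicate_card_le[OF A(1,2), of "k - 1"] rk(2) by (simp add: T_def a_def)
  also have "\<dots> * a = a ^ (2 * k)"
    using k by (cases k) auto
  finally have Ta: "T * a \<le> a ^ (2 * k)" using a by (simp add: mult_right_mono)
  \<comment> \<open>With \<open>T = c * a ^ (2 * k - 1)\<close> this is \<open>a / c\<close>, the
    argument of the logarithm.\<close>
  define x where "x = a ^ (2 * k) / T"
  have "2 * T \<le> T * a" using a T by simp
  also note Ta
  finally have x: "x \<ge> 2" using T by (simp add: x_def pos_le_divide_eq)
  define L where "L = log 2 x"
  have L: "L \<ge> 1" using x by (simp add: L_def le_log_iff)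
  \<comment> \<open>As \<open>card A \<ge> 2\<close> makes the logarithm at least 1, rounding it up
    at most doubles it.\<close>
  define p where "p = nat \<lceil>L\<rceil>"
  have p: "p \<ge> 1" "real p \<le> 2 * L" "L \<le> real p"
    using L unfolding p_def by linarith+
  have "x = 2 powr L" using x by (simp add: L_def)
  also have "\<dots> \<le> 2 powr real p" using p(3) by simp
  also have "\<dots> = 2 ^ p" by (simp add: powr_realpow)
  finally have xp: "x \<le> 2 ^ p" .
  have TT': "T \<le> a ^ 2 * T'"
    using tuple_energy_Cons_le[OF A(1,2) fs, of "k - 1"] rk(1) by (simp add: T_def T'_def a_def)
  \<comment> \<open>Towards the condition on \<open>p\<close> in
    \<open>tuple_energy_dissociated_Cons_le\<close>: since \<open>T \<le> a ^ 2 * T'\<close>, the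
    ratio \<open>a ^ (2 * (k - 1)) / T'\<close> is at most \<open>x\<close>.\<close>
  have "a ^ (2 * (k - 1)) * T \<le> a ^ (2 * (k - 1)) * (a ^ 2 * T')"
    using TT' a by (intro mult_left_mono) auto
  also have "\<dots> = a ^ (2 * k) * T'"
    using k by (cases k) (auto simp: power2_eq_square)
  also have "\<dots> = x * T * T'" using T by (simp add: x_def)
  also have "\<dots> \<le> 2 ^ p * T * T'" using xp T by (intro mult_right_mono) auto
  finally have ap: "a ^ (2 * (k - 1)) \<le> 2 ^ p * T'" using T by (simp add: mult_ac)
  define Q where "Q = T' * a ^ 2 / T"
  have Q: "Q \<ge> 1" "Q * T = a ^ 2 * T'" using TT' T by (simp_all add: Q_def field_simps)
  \<comment> \<open>The constant is 8 * 16: 8 comes from the bound for one dissociated set, and 16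
    is chosen because \<open>S \<le> T / 16\<close> makes the loss \<open>2 * sqrt (T * S)\<close>
    at most \<open>T / 2\<close>.\<close>
  define d where "d = nat \<lceil>128 * real p * Q\<rceil>"
  have pQ: "1 \<le> real p * Q" using p(1) Q(1) mult_mono[of 1 "real p" 1 Q] by simp
  have d: "d \<ge> 1" "128 * real p * Q \<le> real d" "real d \<le> 128 * real p * Q + 1"
    using pQ unfolding d_def by linarith+
  obtain A' \<D> where D: "A' \<subseteq> A" "finite \<D>" "\<Union>\<D> = A - A'" "d * card \<D> \<le> card A"
    "\<forall>\<Lambda>\<in>\<D>. dissociated G \<Lambda> \<and> card \<Lambda> = d" "\<forall>\<Lambda>\<subseteq>A'. dissociated G \<Lambda> \<longrightarrow> card \<Lambda> < d"
    using exhaust_dissociated[OF A(1) d(1)] by blast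
  let ?R = "replicate (k - 1) A"
  define S where "S = tuple_energy ((A - A') # ?R)"
  define s where "s = real (card \<D>)"
  define M where "M = 8 * real p * real d * T'"
  have M: "M \<ge> 0" using T by (simp add: M_def)
  have "fibre_norm (tuples ((A - A') # ?R)) lprod \<le> (\<Sum>\<Lambda>\<in>\<D>. fibre_norm (tuples (\<Lambda> # ?R)) lprod)"
  proof (rule fibre_norm_cover)
    show "finite (tuples (\<Lambda> # ?R))" if "\<Lambda> \<in> \<D>" for \<Lambda>
      using D(5) that A by (intro finite_tuples) (auto simp: dissociated_def)
    show "tuples ((A - A') # ?R) \<subseteq> (\<Union>\<Lambda>\<in>\<D>. tuples (\<Lambda> # ?R))"
      unfolding D(3)[symmetric] by (auto simp: tuples_Cons)
  qed fact
  also have "\<dots> \<le> (\<Sum>\<Lambda>\<in>\<D>. sqrt M)"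
  proof (rule sum_mono)
    fix \<Lambda> assume "\<Lambda> \<in> \<D>"
    then have \<Lambda>: "dissociated G \<Lambda>" "card \<Lambda> = d" using D(5) by auto
    then have "\<Lambda> \<noteq> {}" using d(1) by auto
    then have "tuple_energy (\<Lambda> # ?R) \<le> M"
      using tuple_energy_dissociated_Cons_le[OF A(1,2) ne \<Lambda>(1) _ p(1), of "k - 1"] ap \<Lambda>(2)
      by (simp add: M_def T'_def a_def)
    then show "fibre_norm (tuples (\<Lambda> # ?R)) lprod \<le> sqrt M"
      unfolding fibre_norm_def tuple_energy_def[symmetric] by simp
  qed
  finally have "fibre_norm (tuples ((A - A') # ?R)) lprod \<le> s * sqrt M" by (simp add: s_def)
  then have "S \<le> (s * sqrt M) ^ 2"
    unfolding S_def tuple_energy_eq_fibre_norm by (intro power_mono fibre_norm_nonneg)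
  then have SM: "S \<le> s ^ 2 * M" using M by (simp add: power_mult_distrib)
  have "real d * s \<le> a"
    using D(4) unfolding s_def a_def of_nat_mult[symmetric] of_nat_le_iff .
  then have ds: "(real d * s) ^ 2 \<le> a ^ 2" by (intro power_mono) (auto simp: s_def)
  have "S * real d \<le> s ^ 2 * M * real d" using SM by (intro mult_right_mono) auto
  also have "\<dots> = 8 * real p * T' * (real d * s) ^ 2" by (simp add: M_def power2_eq_square)
  also have "\<dots> \<le> 8 * real p * T' * a ^ 2" using ds T by (intro mult_left_mono) auto
  also have "\<dots> = 8 * real p * Q * T" using Q(2) by simp
  also have "\<dots> \<le> real d / 16 * T" using d(2) T by (intro mult_right_mono) auto
  finally have "S * real d \<le> (T / 16) * real d" by (simp add: mult_ac)
  then have "S \<le> T / 16" using d(1) by (simp add: mult_le_cancel_right)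
  then have "T * S \<le> (T / 4) ^ 2" using T by (simp add: power2_eq_square)
  then have "sqrt (T * S) \<le> T / 4" using T by (intro real_le_lsqrt) auto
  then have "coincidences (tuples (replicate k A)) lprod (tuples (A' # A' # replicate (k - 2) A)) lprod \<ge> T / 2"
    using coincidences_last_two_ge[OF A(1,2) D(1) k] unfolding S_def T_def by linarith
  moreover have "real (diss_dim G A') \<le> 258 * (T' * a ^ 2 / T) * log 2 (a ^ (2 * k) / T)"
  proof -
    have "diss_dim G A' \<le> d"
      using D(1,6) A(1) finite_subset by (intro diss_dim_le) (auto intro: less_imp_le)
    then have "real (diss_dim G A') \<le> 128 * real p * Q + 1" using d(3) by linarith
    \<comment> \<open>Rounding \<open>d\<close> is absorbed by \<open>p * Q \<ge> 1\<close>, and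
      \<open>p \<le> 2 * L\<close> then gives 258 = 2 * 129.\<close>
    also have "\<dots> \<le> 129 * (real p * Q)" using pQ by linarith
    also have "\<dots> \<le> 129 * (2 * L * Q)" using p(2) Q(1) by (intro mult_left_mono mult_right_mono) auto
    finally show ?thesis by (simp add: Q_def L_def x_def mult_ac)
  qed
  ultimately show ?thesis using D(1) by blast
qed

section \<open>The bound in terms of the density, and the size of the subset\<close>

text \<open>Interpolation gives \<open>T' ^ (k - 1) \<le> T ^ (k - 2) * a\<close>, hence the
  \<open>(k - 1)\<close>-th power of the ratio is at most \<open>a ^ (2 * k - 1) / T\<close>, the
  inverse of the density.\<close>

lemma energy_ratio_le:
  assumes A: "finite A" "A \<subseteq> carrier G" "A \<noteq> {}" and k: "k \<ge> 2"
  defines "a \<equiv> real (card A)" and "T \<equiv> tuple_energy (replicate k A)" and "T' \<equiv> tuple_energy (replicate (k - 1) A)"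
  shows "T' * a ^ 2 / T \<le> (T / a ^ (2 * k - 1)) powr (- 1 / (real k - 1))"
proof -
  obtain n where n: "k = Suc n" "n \<ge> 1" using k by (cases k) auto
  have a: "a > 0" using A by (simp add: a_def card_gt_0_iff)
  have T: "T > 0" "T' > 0" unfolding T_def T'_def using A by (auto intro!: tuple_energy_pos)
  have fs: "set (replicate n A) \<subseteq> fin_subsets" using A by auto
  \<comment> \<open>One copy of \<open>A\<close> is kept aside as \<open>Z\<close>, so that without
    the padding the three lists have \<open>k - 1\<close>, \<open>k\<close> and 1 copies of
    \<open>A\<close>.\<close>
  have "tuple_energy ({\<one>} # replicate (n - 1) A @ [A]) ^ n
      \<le> tuple_energy (replicate n A @ [A]) ^ (n - 1) * tuple_energy (replicate n {\<one>} @ [A])"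
    using A n by (intro tuple_energy_interpolate) auto
  moreover have "replicate (n - 1) A @ [A] = replicate n A"
    using n(2) by (cases n) (auto simp: replicate_append_same)
  moreover have "replicate n A @ [A] = replicate k A"
    by (simp add: n(1) replicate_append_same)
  ultimately have "T' ^ n \<le> T ^ (n - 1) * tuple_energy [A]"
    using tuple_energy_Cons_one[OF fs] tuple_energy_replicate_one[of "[A]" n] A n(1)
    by (simp add: T_def T'_def)
  also have "\<dots> \<le> T ^ (n - 1) * a"
    using T tuple_energy_singleton_le[OF A(1,2)] by (intro mult_left_mono) (auto simp: a_def)
  finally have T'n: "T' ^ n \<le> T ^ (n - 1) * a" .
  define Q where "Q = T' * a ^ 2 / T"
  have Q: "Q > 0" using T a by (simp add: Q_def)
  have "Q ^ n = T' ^ n * (a ^ 2) ^ n / T ^ n"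
    by (simp add: Q_def power_divide power_mult_distrib)
  also have "\<dots> \<le> (T ^ (n - 1) * a) * (a ^ 2) ^ n / T ^ n"
    using T'n T a by (intro divide_right_mono mult_right_mono) auto
  also have "\<dots> = a * (a ^ 2) ^ n / T"
    using T n(2) by (cases n) auto
  also have "\<dots> = inverse (T / a ^ (2 * k - 1))"
    by (simp add: n(1) power_mult[symmetric])
  finally have "Q ^ n \<le> inverse (T / a ^ (2 * k - 1))" .
  then have "(Q ^ n) powr (1 / n) \<le> inverse (T / a ^ (2 * k - 1)) powr (1 / n)"
    using Q by (intro powr_mono2) auto
  moreover have "(Q ^ n) powr (1 / n) = Q"
    using Q n(2) by (simp add: powr_realpow[symmetric] powr_powr)
  moreover have "inverse (T / a ^ (2 * k - 1)) powr (1 / n) = (T / a ^ (2 * k - 1)) powr (- 1 / (real k - 1))"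
    using T a by (simp add: n(1) powr_minus powr_divide inverse_eq_divide)
  ultimately show ?thesis by (simp add: Q_def)
qed

text \<open>Enlarging one of the two copies of \<open>A'\<close> to \<open>A\<close> and applying
  Cauchy-Schwarz gives \<open>T \<le> 1024 * S\<close>, where 1024 is the square of
  \<open>2 ^ 5\<close>. Interpolation bounds \<open>S ^ k\<close> by \<open>T ^ (k - 1)\<close>
  times the energy of \<open>A'\<close>, which is trivially at most
  \<open>card A' ^ (2 * k - 1)\<close>.\<close>

lemma card_ge_of_energy_ge:
  assumes A: "finite A" "A \<subseteq> carrier G" "A \<noteq> {}" and k: "k \<ge> 2" and A': "A' \<subseteq> A"
  defines "a \<equiv> real (card A)" and "T \<equiv> tuple_energy (replicate k A)"
  assumes large: "coincidences (tuples (replicate k A)) lprod (tuples (A' # A' # replicate (k - 2) A)) lprod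
    \<ge> 1 / 2 ^ 5 * T"
  shows "real (card A') \<ge> 1 / 2 ^ 7 * (T / a ^ (2 * k - 1)) powr (1 / (2 * real k - 1)) * a"
proof -
  define m where "m = 2 * k - 1"
  define b where "b = real (card A')"
  have m: "m > 0" "real m = 2 * real k - 1" using k by (auto simp: m_def)
  have a: "a > 0" using A by (simp add: a_def card_gt_0_iff)
  have T: "T > 0" unfolding T_def using A by (auto intro!: tuple_energy_pos)
  have B: "finite A'" "A' \<subseteq> carrier G" using A A' finite_subset by auto
  have "A' \<noteq> {}"
  proof
    assume "A' = {}"
    then have "coincidences (tuples (replicate k A)) lprod (tuples (A' # A' # replicate (k - 2) A)) lprod = 0"
      by (simp add: coincidences_def tuples_Cons)
    then show False using large T by simp
  qed
  have r: "replicate (k - 1) A = A # replicate (k - 2) A"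
    using k by (auto simp flip: replicate_Suc simp: Suc_diff_Suc)
  define S where "S = tuple_energy (A' # replicate (k - 1) A)"
  have S0: "S \<ge> 0" by (simp add: S_def tuple_energy_nonneg)
  let ?X = "tuples (replicate k A)"
  have fin: "finite ?X" "finite (tuples (A' # replicate (k - 1) A))"
    using A B by (auto intro!: finite_tuples)
  have "1 / 2 ^ 5 * T \<le> coincidences ?X lprod (tuples (A' # replicate (k - 1) A)) lprod"
    using A' fin unfolding r by (intro order_trans[OF large] coincidences_mono) (auto simp: tuples_Cons)
  also have "\<dots> \<le> fibre_norm ?X lprod * fibre_norm (tuples (A' # replicate (k - 1) A)) lprod"
    using fin by (rule coincidences_Cauchy_Schwarz)
  finally have "(1 / 2 ^ 5 * T) ^ 2 \<le> (fibre_norm ?X lprod * fibre_norm (tuples (A' # replicate (k - 1) A)) lprod) ^ 2"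
    using T by (intro power_mono) auto
  also have "\<dots> = T * S"
    by (simp add: T_def S_def tuple_energy_eq_fibre_norm power_mult_distrib)
  finally have "T * T \<le> T * (1024 * S)"
    by (simp add: power2_eq_square)
  then have TS: "T \<le> 1024 * S" using T by simp
  have "S ^ k \<le> T ^ (k - 1) * tuple_energy (replicate k A')"
    using tuple_energy_interpolate[of A A' "[]" k] A B k \<open>A' \<noteq> {}\<close> by (simp add: S_def T_def)
  also have "\<dots> \<le> T ^ (k - 1) * b ^ m"
    using tuple_energy_replicate_card_le[OF B, of "k - 1"] T k
    by (intro mult_left_mono) (auto simp: b_def m_def eval_nat_numeral Suc_diff_Suc)
  finally have "1024 ^ k * S ^ k \<le> 1024 ^ k * (T ^ (k - 1) * b ^ m)" by simp
  moreover have "T ^ k \<le> (1024 * S) ^ k" using TS T by (intro power_mono) auto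
  ultimately have "T ^ k \<le> 1024 ^ k * (T ^ (k - 1) * b ^ m)" unfolding power_mult_distrib by linarith
  moreover have "T ^ k = T ^ (k - 1) * T" using k by (cases k) auto
  ultimately have "T ^ (k - 1) * T \<le> T ^ (k - 1) * (1024 ^ k * b ^ m)" by (simp add: mult_ac)
  then have Tb: "T \<le> 1024 ^ k * b ^ m" using T by simp
  have root: "(y powr (1 / m)) ^ m = y" if "y > 0" for y :: real
    using that m(1) by (simp add: powr_powr flip: powr_realpow)
  have "(1 / 2 ^ 7 * (T / a ^ m) powr (1 / m) * a) ^ m = (1 / 2 ^ 7) ^ m * (T / a ^ m) * a ^ m"
    unfolding power_mult_distrib
    using root[of "T / a ^ m"] T a by simp
  also have "\<dots> = (1 / 2 ^ 7) ^ m * T" using a by simp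
  also have "\<dots> \<le> (1 / 2 ^ 7) ^ m * (1024 ^ k * b ^ m)" using Tb by (intro mult_left_mono) auto
  also have "\<dots> \<le> 1 * b ^ m"
  proof -
    have "(1024::real) ^ k = 2 ^ (10 * k)" by (simp add: power_mult)
    \<comment> \<open>This is \<open>10 * k \<le> 7 * (2 * k - 1)\<close>, which holds for
      \<open>k \<ge> 2\<close>; for \<open>k = 2\<close> no integer below 7 would do.\<close>
    also have "\<dots> \<le> 2 ^ (7 * m)" using k by (intro power_increasing) (auto simp: m_def)
    also have "\<dots> = 128 ^ m" by (simp add: power_mult)
    finally have "(1 / 2 ^ 7) ^ m * (1024::real) ^ k \<le> 1"
      by (simp add: power_divide)
    then show ?thesis
      unfolding mult.assoc[symmetric] by (intro mult_right_mono) (auto simp: b_def)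
  qed
  finally have "(1 / 2 ^ 7 * (T / a ^ m) powr (1 / m) * a) ^ m \<le> b ^ m" by simp
  then have "1 / 2 ^ 7 * (T / a ^ m) powr (1 / m) * a \<le> b"
    using m(1) by (subst (asm) power_mono_iff) (use a in \<open>auto simp: b_def\<close>)
  then show ?thesis unfolding m(2) by (simp only: b_def m_def)
qed

end

text \<open>If \<open>A = {x}\<close>, the density is 1 and the logarithm vanishes, while
  \<open>A'\<close> has to be \<open>{x}\<close>, of dimension 1 when \<open>x\<close> is not the
  identity. Hence the exception in the first dimension bound.\<close>

theorem proposition21:
  "\<exists>c\<^sub>0 C :: real. c\<^sub>0 > 0 \<and> C > 0 \<and>
     (\<forall>(G :: 'g monoid) (A :: 'g set) (k :: nat) (c :: real).
        comm_group G \<longrightarrow> A \<subseteq> carrier G \<longrightarrow> finite A \<longrightarrow> k \<ge> 2 \<longrightarrow>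
        real (energy G k A) = c * real (card A) ^ (2*k - 1) \<longrightarrow>
        (\<exists>A' \<subseteq> A.
           real (add_energy G k (\<lambda>i. if i \<le> 2*k - 2 then A else A'))
             \<ge> 1 / 2 ^ 5 * real (energy G k A) \<and>
           (\<not> (\<exists>x. x \<noteq> \<one>\<^bsub>G\<^esub> \<and> A = {x}) \<longrightarrow>
              real (diss_dim G A')
                \<le> C * (real (energy G (k - 1) A) * real (card A) ^ 2 / real (energy G k A))
                    * log 2 (inverse c * real (card A))) \<and>
           C * (real (energy G (k - 1) A) * real (card A) ^ 2 / real (energy G k A))
               * log 2 (inverse c * real (card A))
             \<le> C * c powr (- 1 / (real k - 1)) * log 2 (inverse c * real (card A)) \<and>
           real (card A') \<ge> c\<^sub>0 * c powr (1 / (2 * real k - 1)) * real (card A)))"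
proof (rule exI[of _ "1 / 2 ^ 7"], rule exI[of _ 258], intro conjI allI impI)
  fix G :: "'g monoid" and A :: "'g set" and k :: nat and c :: real
  assume "comm_group G" and A: "A \<subseteq> carrier G" "finite A" and k: "k \<ge> 2"
    and E: "real (energy G k A) = c * real (card A) ^ (2*k - 1)"
  interpret comm_group G by fact
  define a where "a = real (card A)"
  define T where "T = tuple_energy (replicate k A)"
  define T' where "T' = tuple_energy (replicate (k - 1) A)"
  have energy: "real (energy G k A) = T" "real (energy G (k - 1) A) = T'"
    using A(1) by (simp_all add: T_def T'_def energy_eq_tuple_energy)
  let ?N = "\<lambda>A'. real (add_energy G k (\<lambda>i. if i \<le> 2*k - 2 then A else A'))"
  let ?D = "258 * (T' * a ^ 2 / T) * log 2 (inverse c * a)"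
  have N: "?N A' = coincidences (tuples (replicate k A)) lprod (tuples (A' # A' # replicate (k - 2) A)) lprod"
    if "A' \<subseteq> A" for A'
    using A(1) that k by (rule add_energy_last_two)
  have "\<exists>A'\<subseteq>A. 1 / 2 ^ 5 * T \<le> ?N A' \<and>
      (\<not> (\<exists>x. x \<noteq> \<one>\<^bsub>G\<^esub> \<and> A = {x}) \<longrightarrow> real (diss_dim G A') \<le> ?D) \<and>
      ?D \<le> 258 * c powr (- 1 / (real k - 1)) * log 2 (inverse c * a) \<and>
      1 / 2 ^ 7 * c powr (1 / (2 * real k - 1)) * a \<le> real (card A')"
  proof (cases "A = {}")
    case True
    \<comment> \<open>For the empty set \<open>c\<close> is arbitrary, but the cardinality 0 and
      \<open>ln 0 = 0\<close> make both sides of every bound vanish.\<close>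
    have "T = 0" using E k True unfolding energy by simp
    moreover have "diss_dim G {} \<le> 0" by (rule diss_dim_le) auto
    ultimately show ?thesis using True by (auto simp: a_def log_def)
  next
    case ne: False
    have a: "a > 0" using ne A by (simp add: a_def card_gt_0_iff)
    have T: "T > 0" "T' > 0" unfolding T_def T'_def using A ne by (auto intro!: tuple_energy_pos)
    have c: "c = T / a ^ (2 * k - 1)" using E a by (simp add: energy a_def)
    have ic: "inverse c * a = a ^ (2 * k) / T"
      using k by (cases k) (auto simp: c)
    have ratio: "T' * a ^ 2 / T \<le> c powr (- 1 / (real k - 1))"
      using energy_ratio_le[OF A(2,1) ne k] by (simp add: c a_def T_def T'_def)
    have size: "1 / 2 ^ 7 * c powr (1 / (2 * real k - 1)) * a \<le> real (card A')"
      if "A' \<subseteq> A" "1 / 2 ^ 5 * T \<le> ?N A'" for A'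
      using card_ge_of_energy_ge[OF A(2,1) ne k that(1)] that(2) N[OF that(1)]
      by (simp add: c a_def T_def)
    \<comment> \<open>The logarithm has to be nonnegative before \<open>ratio\<close> can be
      multiplied by it.\<close>
    have "T \<le> a ^ (2 * (k - 1) + 1)"
      using tuple_energy_replicate_card_le[OF A(2,1), of "k - 1"] k by (simp add: T_def a_def)
    then have Ta: "T \<le> a ^ (2 * k - 1)" using k by (cases k) auto
    have "1 \<le> a" using ne A by (simp add: a_def Suc_le_eq card_gt_0_iff)
    moreover have "1 \<le> inverse c" using Ta T a by (simp add: c)
    ultimately have "1 \<le> inverse c * a" using mult_mono[of 1 "inverse c" 1 a] T a c by simp
    then have "0 \<le> log 2 (inverse c * a)" by simp
    with ratio have D: "?D \<le> 258 * c powr (- 1 / (real k - 1)) * log 2 (inverse c * a)"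
      by (intro mult_right_mono mult_left_mono) auto
    have "\<exists>A'\<subseteq>A. 1 / 2 ^ 5 * T \<le> ?N A' \<and>
        (\<not> (\<exists>x. x \<noteq> \<one>\<^bsub>G\<^esub> \<and> A = {x}) \<longrightarrow> real (diss_dim G A') \<le> ?D)"
    proof (cases "card A \<ge> 2")
      case True
      obtain A' where A': "A' \<subseteq> A"
          "T / 2 \<le> coincidences (tuples (replicate k A)) lprod (tuples (A' # A' # replicate (k - 2) A)) lprod"
          "real (diss_dim G A') \<le> ?D"
        using exists_small_dim_subset[OF A(2,1) True k] unfolding ic
        by (auto simp: a_def T_def T'_def)
      then show ?thesis using T N[OF A'(1)] by (intro exI[of _ A']) auto
    next
      case False
      then have "card A = 1" using ne A(2) by (simp add: Suc_le_eq order_less_le eval_nat_numeral le_Suc_eq not_le less_Suc_eq)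
      then obtain x where x: "A = {x}" by (auto simp: card_1_singleton_iff)
      have "c = T" using a x by (simp add: c a_def)
      \<comment> \<open>The energy is a natural number, so positivity gives
        \<open>T \<ge> 1\<close>; with the trivial upper bound the density is exactly 1.\<close>
      moreover have "real (energy G k A) > 0" using T(1) energy(1) by simp
      then have "real (energy G k A) \<ge> 1" by (simp add: Suc_le_eq)
      then have "T \<ge> 1" unfolding energy .
      ultimately have "c = 1" using Ta x by (simp add: a_def)
      then have D0: "?D = 0" using x by (simp add: a_def)
      \<comment> \<open>The bound being 0, the dimension must vanish as well; among singletons only
        the identity remains to be checked.\<close>
      have "diss_dim G A \<le> 0" if "x = \<one>\<^bsub>G\<^esub>"
      proof (rule diss_dim_le[OF A(2)])
        fix \<Lambda> assume "\<Lambda> \<subseteq> A" "dissociated G \<Lambda>"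
        then show "card \<Lambda> \<le> 0" using not_dissociated_one[of \<Lambda>] subset_singletonD[of \<Lambda> x] x that by auto
      qed
      moreover have "?N A = T" by (simp add: energy)
      ultimately show ?thesis using T x D0 by (intro exI[of _ A]) auto
    qed
    then show ?thesis using D size by blast
  qed
  then show "\<exists>A'\<subseteq>A.
      real (add_energy G k (\<lambda>i. if i \<le> 2*k - 2 then A else A'))
        \<ge> 1 / 2 ^ 5 * real (energy G k A) \<and>
      (\<not> (\<exists>x. x \<noteq> \<one>\<^bsub>G\<^esub> \<and> A = {x}) \<longrightarrow>
         real (diss_dim G A')
           \<le> 258 * (real (energy G (k - 1) A) * real (card A) ^ 2 / real (energy G k A))
               * log 2 (inverse c * real (card A))) \<and>
      258 * (real (energy G (k - 1) A) * real (card A) ^ 2 / real (energy G k A))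
          * log 2 (inverse c * real (card A))
        \<le> 258 * c powr (- 1 / (real k - 1)) * log 2 (inverse c * real (card A)) \<and>
      real (card A') \<ge> 1 / 2 ^ 7 * c powr (1 / (2 * real k - 1)) * real (card A)"
    unfolding energy a_def by blast
qed simp_all

end
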